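(* Consider the randomly switched system $\dot x = f_\sigma(x)$, $(x(0),\sigma(0))=(x_0,\sigma_0)$, $t\ge 0$. Suppose that: (U1) there exist continuously differentiable functions $V_i:\mathbb{R}^n\to\mathbb{R}$, $i\in\mathcal P$, functions $\alpha_1,\alpha_2\in\mathcal K_\infty$, and numbers $\mu>1$ and $\lambda_i\in\mathbb{R}$, $i\in\mathcal P$, such that for all $x\in\mathbb{R}^n$ and $i,j\in\mathcal P$: $\alpha_1(\|x\|)\le V_i(x)\le\alpha_2(\|x\|)$; $\langle\nabla V_i(x), f_i(x)\rangle\le -\lambda_i V_i(x)$; $V_i(x)\le\mu V_j(x)$; (U2) the switching signal $\sigma$ belongs to class UH with parameters $T>0$ and $q_i\in[0,1]$, $i\in\mathcal P$; (U3) $\displaystyle\sum_{i\in\mathcal P}\frac{\mu q_i\left(1-e^{-\lambda_i T}\right)}{\lambda_i T}<1$. Then the system is globally asymptotically stable almost surely.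
   Context: Notation: $\mathbb{N}=\{1,2,\dots\}$, $\mathbb{N}_0=\mathbb{N}\cup\{0\}$, $\|\cdot\|$ is the Euclidean norm. A function $\alpha:[0,\infty[\to[0,\infty[$ is of class $\mathcal K$ if it is continuous, strictly increasing and $\alpha(0)=0$; it is of class $\mathcal K_\infty$ if in addition it is unbounded. The ratio $(1-e^{-\lambda_iT})/(\lambda_iT)$ is understood as $1$ when $\lambda_i=0$. Setting: $\mathcal P=\{1,\dots,\mathrm N\}$ is a finite index set; for each $i\in\mathcal P$ the vector field $f_i:\mathbb{R}^n\to\mathbb{R}^n$ is locally Lipschitz with $f_i(0)=0$. On a complete probability space $(\Omega,\mathfrak F,\mathsf P)$, the switching signal $\sigma=(\sigma(t))_{t\ge0}$ is a càdlàg $\mathcal P$-valued process with $\sigma(0)=\sigma_0$ deterministic. Its switching instants are $0=\tau_0<\tau_1<\tau_2<\cdots$ (almost surely); $\sigma$ is constant on each $[\tau_i,\tau_{i+1}[$, and $\sigma(\tau_i)=\sigma(\tau_{i-1})$ is allowed. The holding times are $S_i:=\tau_i-\tau_{i-1}$, $i\in\mathbb{N}$. The state $x$ does not jump at switching instants, and $x(\cdot)$ denotes the (pathwise, Carathéodory, absolutely continuous) solution of the switched system for the initial state $x_0$; it depends on $x_0$ and $\omega\in\Omega$. Class UH: $\sigma$ belongs to class UH if (UH1) $(S_i)_{i\in\mathbb{N}}$ is i.i.d., each $S_i$ uniformly distributed on $[0,T]$, $T>0$; (UH2) there exist $q_i\in[0,1]$, $i\in\mathcal P$, such that for all $j\in\mathbb{N}$,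 $\mathsf P\big(\sigma(\tau_j)=i\,\big|\,(\sigma(\tau_k))_{k=0}^{j-1}\big)=q_i$; (UH3) the sequences $(S_i)_{i\in\mathbb{N}}$ and $(\sigma(\tau_i))_{i\in\mathbb{N}_0}$ are mutually independent. Global asymptotic stability almost surely means: (AS1) with probability one, for every $\varepsilon>0$ there is $\delta>0$ such that for every $x_0$, $\|x_0\|<\delta$ implies $\sup_{t\ge0}\|x(t)\|<\varepsilon$; and (AS2) with probability one, for all $r,\varepsilon'>0$ there is $T'\ge0$ such that for every $x_0$, $\|x_0\|<r$ implies $\sup_{t\ge T'}\|x(t)\|<\varepsilon'$. ($\delta$ and $T'$ may depend on $\omega$.) *)

theory Defs
  imports "HOL-Probability.Probability"
begin

section \<open>Comparison functions and gradients\<close>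

text \<open>Comparison functions live on \<open>[0,\<infinity>[\<close>; their values at negative arguments are irrelevant.\<close>

definition class_K :: "(real \<Rightarrow> real) \<Rightarrow> bool" where
  "class_K \<alpha> \<longleftrightarrow> continuous_on {0..} \<alpha> \<and> strict_mono_on {0..} \<alpha> \<and> \<alpha> 0 = 0"

definition class_K_inf :: "(real \<Rightarrow> real) \<Rightarrow> bool" where
  "class_K_inf \<alpha> \<longleftrightarrow> class_K \<alpha> \<and> \<not> bounded (\<alpha> ` {0..})"

definition gradient :: "('a::real_inner \<Rightarrow> real) \<Rightarrow> 'a \<Rightarrow> 'a" where
  "gradient V x = (THE D. GDERIV V x :> D)"

definition continuously_differentiable :: "('a::euclidean_space \<Rightarrow> real) \<Rightarrow> bool" where
  "continuously_differentiable V \<longleftrightarrow>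
     (\<forall>x. V differentiable (at x)) \<and> continuous_on UNIV (gradient V)"

section \<open>Caratheodory solutions of the switched system\<close>

text \<open>The sum condition ranges over finite families of non-overlapping subintervals
  \<open>[u k, v k]\<close>, \<open>k < m\<close>, of \<open>[a, b]\<close>.\<close>

definition abs_continuous :: "real \<Rightarrow> real \<Rightarrow> (real \<Rightarrow> 'a::real_normed_vector) \<Rightarrow> bool" where
  "abs_continuous a b x \<longleftrightarrow>
     (\<forall>\<epsilon>>0. \<exists>\<delta>>0. \<forall>(m::nat) (u::nat \<Rightarrow> real) (v::nat \<Rightarrow> real).
        (\<forall>k<m. a \<le> u k \<and> u k \<le> v k \<and> v k \<le> b) \<and>
        (\<forall>k<m. \<forall>l<m. k \<noteq> l \<longrightarrow> {u k<..<v k} \<inter> {u l<..<v l} = {}) \<and>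
        (\<Sum>k<m. v k - u k) < \<delta>
        \<longrightarrow> (\<Sum>k<m. norm (x (v k) - x (u k))) < \<epsilon>)"

text \<open>\<open>s\<close> is one path of the switching signal. Only the values of \<open>s\<close> and \<open>x\<close> on
  \<open>[0,\<infinity>[\<close> are constrained.\<close>

definition is_solution ::
    "(nat \<Rightarrow> 'a::real_normed_vector \<Rightarrow> 'a) \<Rightarrow> (real \<Rightarrow> nat) \<Rightarrow> 'a \<Rightarrow> (real \<Rightarrow> 'a) \<Rightarrow> bool" where
  "is_solution f s x0 x \<longleftrightarrow>
     x 0 = x0 \<and>
     (\<forall>b>0. abs_continuous 0 b x) \<and>
     (AE t in lborel. 0 < t \<longrightarrow> (x has_vector_derivative f (s t) (x t)) (at t))"

section \<open>Switching signals\<close>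

definition cadlag :: "(real \<Rightarrow> 'a::topological_space) \<Rightarrow> bool" where
  "cadlag s \<longleftrightarrow>
     (\<forall>t\<ge>0. (s \<longlongrightarrow> s t) (at_right t)) \<and>
     (\<forall>t>0. \<exists>l. (s \<longlongrightarrow> l) (at_left t))"

text \<open>A signal with values in \<open>{1..N}\<close> is given together with its switching instants \<open>\<tau>\<close>:
  since \<open>\<sigma>\<close> may keep its value at an instant, \<open>\<tau>\<close> is not determined by \<open>\<sigma>\<close>.\<close>

definition switching_signal ::
    "'w measure \<Rightarrow> nat \<Rightarrow> (real \<Rightarrow> 'w \<Rightarrow> nat) \<Rightarrow> nat \<Rightarrow> (nat \<Rightarrow> 'w \<Rightarrow> real) \<Rightarrow> bool" where
  "switching_signal M N \<sigma> \<sigma>0 \<tau> \<longleftrightarrow>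
     (\<forall>t\<ge>0. \<sigma> t \<in> measurable M (count_space {1..N})) \<and>
     (AE \<omega> in M. cadlag (\<lambda>t. \<sigma> t \<omega>)) \<and>
     \<sigma>0 \<in> {1..N} \<and> (AE \<omega> in M. \<sigma> 0 \<omega> = \<sigma>0) \<and>
     (\<forall>i. \<tau> i \<in> borel_measurable M) \<and>
     (AE \<omega> in M. \<tau> 0 \<omega> = 0 \<and> (\<forall>i. \<tau> i \<omega> < \<tau> (Suc i) \<omega>)) \<and>
     (AE \<omega> in M. \<forall>i. \<forall>t. \<tau> i \<omega> \<le> t \<and> t < \<tau> (Suc i) \<omega> \<longrightarrow> \<sigma> t \<omega> = \<sigma> (\<tau> i \<omega>) \<omega>)"

definition holding_time :: "(nat \<Rightarrow> 'w \<Rightarrow> real) \<Rightarrow> nat \<Rightarrow> 'w \<Rightarrow> real" where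
  "holding_time \<tau> i \<omega> = \<tau> i \<omega> - \<tau> (i - 1) \<omega>"

definition mode :: "(real \<Rightarrow> 'w \<Rightarrow> nat) \<Rightarrow> (nat \<Rightarrow> 'w \<Rightarrow> real) \<Rightarrow> nat \<Rightarrow> 'w \<Rightarrow> nat" where
  "mode \<sigma> \<tau> k \<omega> = \<sigma> (\<tau> k \<omega>) \<omega>"

text \<open>The sigma-algebra generated by the first \<open>j\<close> modes, with indices \<open>0, \<dots>, j - 1\<close>.\<close>

definition mode_history ::
    "'w measure \<Rightarrow> (real \<Rightarrow> 'w \<Rightarrow> nat) \<Rightarrow> (nat \<Rightarrow> 'w \<Rightarrow> real) \<Rightarrow> nat \<Rightarrow> 'w measure" where
  "mode_history M \<sigma> \<tau> j =
     vimage_algebra (space M) (\<lambda>\<omega>. \<lambda>k\<in>{0..<j}. mode \<sigma> \<tau> k \<omega>)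
       (\<Pi>\<^sub>M k\<in>{0..<j}. count_space UNIV)"

definition class_UH ::
    "'w measure \<Rightarrow> nat \<Rightarrow> (real \<Rightarrow> 'w \<Rightarrow> nat) \<Rightarrow> (nat \<Rightarrow> 'w \<Rightarrow> real) \<Rightarrow> real \<Rightarrow> (nat \<Rightarrow> real) \<Rightarrow> bool"
  where
  "class_UH M N \<sigma> \<tau> T q \<longleftrightarrow>
     \<comment> \<open>UH1\<close>
     T > 0 \<and>
     prob_space.indep_vars M (\<lambda>_. borel) (holding_time \<tau>) {1..} \<and>
     (\<forall>i\<ge>1. distr M lborel (holding_time \<tau> i) = uniform_measure lborel {0..T}) \<and>
     \<comment> \<open>UH2\<close>
     (\<forall>i\<in>{1..N}. 0 \<le> q i \<and> q i \<le> 1) \<and>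
     (\<forall>j\<ge>1. \<forall>i\<in>{1..N}. AE \<omega> in M.
        real_cond_exp M (mode_history M \<sigma> \<tau> j)
          (indicator {\<omega>' \<in> space M. mode \<sigma> \<tau> j \<omega>' = i}) \<omega> = q i) \<and>
     \<comment> \<open>UH3\<close>
     prob_space.indep_var M
       (\<Pi>\<^sub>M i\<in>{1..}. borel) (\<lambda>\<omega>. \<lambda>i\<in>{1..}. holding_time \<tau> i \<omega>)
       (\<Pi>\<^sub>M k\<in>UNIV. count_space UNIV) (\<lambda>\<omega> k. mode \<sigma> \<tau> k \<omega>)"

text \<open>The continuous extension to \<open>l = 0\<close> of the Laplace transform of the uniform
  distribution on \<open>[0,T]\<close>.\<close>

definition uniform_ratio :: "real \<Rightarrow> real \<Rightarrow> real" where
  "uniform_ratio T l = (if l = 0 then 1 else (1 - exp (- l * T)) / (l * T))"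

section \<open>Global asymptotic stability almost surely\<close>

text \<open>The first conjunct says that almost every path admits a solution on all of \<open>[0,\<infinity>[\<close>
  from every initial state; without it the two stability properties, which speak about every
  solution, could hold vacuously. The suprema are taken in the extended reals, where the
  supremum of an unbounded set is \<open>\<infinity>\<close>.\<close>

definition gas_almost_surely ::
    "'w measure \<Rightarrow> (nat \<Rightarrow> 'a::real_normed_vector \<Rightarrow> 'a) \<Rightarrow> (real \<Rightarrow> 'w \<Rightarrow> nat) \<Rightarrow> bool" where
  "gas_almost_surely M f \<sigma> \<longleftrightarrow>
     (AE \<omega> in M. \<forall>x0. \<exists>x. is_solution f (\<lambda>t. \<sigma> t \<omega>) x0 x) \<and>
     \<comment> \<open>AS1\<close>
     (AE \<omega> in M. \<forall>\<epsilon>>0. \<exists>\<delta>>0. \<forall>x0 x.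
        is_solution f (\<lambda>t. \<sigma> t \<omega>) x0 x \<and> norm x0 < \<delta> \<longrightarrow>
        (SUP t\<in>{0..}. ereal (norm (x t))) < ereal \<epsilon>) \<and>
     \<comment> \<open>AS2\<close>
     (AE \<omega> in M. \<forall>r>0. \<forall>\<epsilon>>0. \<exists>T\<ge>0. \<forall>x0 x.
        is_solution f (\<lambda>t. \<sigma> t \<omega>) x0 x \<and> norm x0 < r \<longrightarrow>
        (SUP t\<in>{T..}. ereal (norm (x t))) < ereal \<epsilon>)"

end

theory Submission
  imports Defs
begin

text \<open>
  Between switching instants \<open>V\<^sub>i\<close> decays at rate \<open>lam i\<close> along solutions, and a switch costs a factor
  of at most \<open>\<mu>\<close>. Hence, on \<open>[\<tau> k, \<tau> (k + 1)[\<close>, \<open>\<alpha>1 \<parallel>x t\<parallel>\<close> is at most a constant times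
  \<open>Z k * \<alpha>2 \<parallel>x 0\<parallel>\<close>, where \<open>Z k\<close> is the product over \<open>j < k\<close> of
  \<open>\<mu> * exp (- lam (mode j) * S (j + 1))\<close>, and both stability properties follow once \<open>Z k\<close> tends to
  \<open>0\<close> and \<open>\<tau> k\<close> to infinity. By the independence assumptions, the expectation of \<open>Z k\<close> is multiplied
  in each step after the first by the sum in (U3), which is less than 1, so the \<open>Z k\<close> have a finite expected sum and tend to
  \<open>0\<close> almost surely. The same statement with all rates and \<open>\<mu>\<close> equal to 1 says \<open>exp (- \<tau> k) \<longlonglongrightarrow> 0\<close>.
\<close>

section \<open>Absolutely continuous functions and Caratheodory solutions\<close>

lemma abs_continuousE:
  assumes "abs_continuous a b x" "\<epsilon> > 0"
  obtains \<delta> where "\<delta> > 0" "\<And>(m::nat) u v.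
      \<lbrakk>\<forall>k<m. a \<le> u k \<and> u k \<le> v k \<and> v k \<le> b;
       \<forall>k<m. \<forall>l<m. k \<noteq> l \<longrightarrow> {u k<..<v k} \<inter> {u l<..<v l} = {};
       (\<Sum>k<m. v k - u k) < \<delta>\<rbrakk> \<Longrightarrow> (\<Sum>k<m. norm (x (v k) - x (u k))) < \<epsilon>"
proof -
  obtain \<delta> where "\<delta> > 0" and "\<forall>(m::nat) u v.
      (\<forall>k<m. a \<le> u k \<and> u k \<le> v k \<and> v k \<le> b) \<and>
      (\<forall>k<m. \<forall>l<m. k \<noteq> l \<longrightarrow> {u k<..<v k} \<inter> {u l<..<v l} = {}) \<and>
      (\<Sum>k<m. v k - u k) < \<delta> \<longrightarrow> (\<Sum>k<m. norm (x (v k) - x (u k))) < \<epsilon>"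
    using assms(1)[unfolded abs_continuous_def, THEN spec, THEN mp, OF assms(2)] by (elim exE conjE)
  then show thesis by (intro that[of \<delta>]) simp_all
qed

text \<open>In a fine tagged division, pieces tagged outside the exceptional null set \<open>E\<close> are handled by
  differentiability; those tagged in \<open>E\<close> lie in an open set of small measure, so that absolute
  continuity bounds their total increment.\<close>

lemma abs_continuous_imp_has_integral:
  fixes x :: "real \<Rightarrow> 'a::euclidean_space"
  assumes ab: "a \<le> b" and ac: "abs_continuous a b x"
    and ae: "AE t in lborel. a < t \<and> t < b \<longrightarrow> (x has_vector_derivative g t) (at t)"
  shows "(g has_integral x b - x a) {a..b}"
proof -
  obtain B where B: "B \<in> null_sets lborel"
    and B_der: "\<And>t. t \<notin> B \<Longrightarrow> a < t \<Longrightarrow> t < b \<Longrightarrow> (x has_vector_derivative g t) (at t)"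
    using ae by (elim AE_E) (force simp: null_sets_def)
  \<comment> \<open>The endpoints join the exceptional set because differentiability is assumed only
    in the open interval.\<close>
  define E where "E = insert a (insert b B)"
  have E_null: "E \<in> null_sets lborel"
    using null_sets.Un[OF finite_imp_null_set_lborel[of "{a, b}"] B] by (simp add: E_def)
  then have E_neg: "negligible E"
    by (simp add: negligible_iff_null_sets null_sets_completionI)
  have E_der: "(x has_vector_derivative g t) (at t)" if "t \<notin> E" "t \<in> {a..b}" for t
    using B_der[of t] that by (auto simp: E_def)
  \<comment> \<open>Resetting \<open>g\<close> to 0 on a negligible set keeps the integral, and a
    piece tagged in \<open>E\<close> then contributes to the error only its increment of
    \<open>x\<close>.\<close>
  define h where "h t = (if t \<in> E then 0 else g t)" for t
  have "(h has_integral x b - x a) {a..b}"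
    unfolding has_integral_real
  proof (intro allI impI)
    fix e :: real assume e: "e > 0"
    \<comment> \<open>The pieces tagged outside \<open>E\<close> will have total error at most
      \<open>e1 * (b - a)\<close>. The added 1 covers the case \<open>a = b\<close>.\<close>
    define e1 where "e1 = e / (2 * (b - a + 1))"
    have e1: "e1 > 0" using e ab by (simp add: e1_def)
    have e1_le: "e1 * (b - a) < e / 2"
      using e ab by (simp add: e1_def divide_simps)
    have "e / 2 > 0" using e by simp
    with ac obtain d where d: "d > 0" and d_ac: "\<And>(m::nat) u v.
        \<lbrakk>\<forall>k<m. a \<le> u k \<and> u k \<le> v k \<and> v k \<le> b;
         \<forall>k<m. \<forall>l<m. k \<noteq> l \<longrightarrow> {u k<..<v k} \<inter> {u l<..<v l} = {};
         (\<Sum>k<m. v k - u k) < d\<rbrakk> \<Longrightarrow> (\<Sum>k<m. norm (x (v k) - x (u k))) < e / 2"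
      by (rule abs_continuousE) (rule that)
    obtain U where U: "open U" "E \<subseteq> U" and U': "emeasure lborel (U - E) < ennreal d"
      by (rule outer_regular_lborel[of E d]) (use E_null d in auto)
    have Ud: "emeasure lborel U < ennreal d"
      using U' E_null U(1) by (simp add: emeasure_Diff_null_set)
    have "\<exists>r>0. t \<notin> E \<longrightarrow> t \<in> {a..b} \<longrightarrow>
        (\<forall>y. \<bar>y - t\<bar> < r \<longrightarrow> norm (x y - x t - (y - t) *\<^sub>R g t) \<le> e1 * \<bar>y - t\<bar>)" for t
    proof (cases "t \<notin> E \<and> t \<in> {a..b}")
      case True
      then show ?thesis
        using E_der[of t] e1
        unfolding has_vector_derivative_def has_derivative_within_alt by force
    next
      case False
      then show ?thesis by (intro exI[of _ 1]) auto
    qed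
    then obtain r where r: "\<And>t. r t > 0" and
      r_le: "\<And>t y. \<lbrakk>t \<notin> E; t \<in> {a..b}; \<bar>y - t\<bar> < r t\<rbrakk> \<Longrightarrow>
        norm (x y - x t - (y - t) *\<^sub>R g t) \<le> e1 * \<bar>y - t\<bar>"
      by metis
    \<comment> \<open>Fineness confines a piece tagged in \<open>E\<close> to the open set
      \<open>U\<close>, and any other piece to the radius on which the derivative estimate at its
      tag holds.\<close>
    define \<gamma> where "\<gamma> t = (if t \<in> E then U else ball t (r t))" for t
    have gauge: "gauge \<gamma>"
      using U r by (auto simp: gauge_def \<gamma>_def)
    have small: "norm ((\<Sum>(t, K)\<in>D. measure lborel K *\<^sub>R h t) - (x b - x a)) < e"
      if D: "D tagged_division_of {a..b}" and fine: "\<gamma> fine D" for D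
    proof -
      have finD: "finite D" using D by blast
      have K: "\<exists>u v. K = {u..v} \<and> a \<le> u \<and> u \<le> t \<and> t \<le> v \<and> v \<le> b \<and> {u..v} \<subseteq> \<gamma> t"
        if tK: "(t, K) \<in> D" for t K
      proof -
        obtain u v where uv: "K = cbox u v"
          using tagged_division_ofD(4)[OF D tK] by auto
        have "t \<in> K" "K \<subseteq> {a..b}" "K \<subseteq> \<gamma> t"
          using tagged_division_ofD(2,3)[OF D tK] fineD[OF fine tK] by auto
        then show ?thesis using uv by (intro exI[of _ u] exI[of _ v]) auto
      qed
      define DE where "DE = {p \<in> D. fst p \<in> E}"
      define F where "F p = norm (x (Sup (snd p)) - x (Inf (snd p)))" for p :: "real \<times> real set"
      have finDE: "finite DE" using finD by (simp add: DE_def)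
      have out: "norm (measure lborel K *\<^sub>R h t - (x (Sup K) - x (Inf K))) \<le> e1 * measure lborel K"
        if tK: "(t, K) \<in> D - DE" for t K
      proof -
        obtain u v where uv: "K = {u..v}" "a \<le> u" "u \<le> t" "t \<le> v" "v \<le> b" "{u..v} \<subseteq> \<gamma> t"
          using K tK by blast
        have tE: "t \<notin> E" using tK by (simp add: DE_def)
        have "u \<in> {u..v}" "v \<in> {u..v}" using uv by auto
        moreover have "{u..v} \<subseteq> ball t (r t)" using uv(6) tE by (simp only: \<gamma>_def if_False)
        ultimately have "u \<in> ball t (r t)" "v \<in> ball t (r t)" by (auto simp only: subset_iff)
        then have "\<bar>u - t\<bar> < r t" "\<bar>v - t\<bar> < r t" by (simp_all add: dist_real_def abs_minus_commute)
        then have *: "norm (x u - x t - (u - t) *\<^sub>R g t) \<le> e1 * \<bar>u - t\<bar>"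
          "norm (x v - x t - (v - t) *\<^sub>R g t) \<le> e1 * \<bar>v - t\<bar>"
          using r_le[OF tE, of u] r_le[OF tE, of v] uv by auto
        \<comment> \<open>The increment over \<open>{u..v}\<close> is split at the tag
          \<open>t\<close>; the two linearisation errors add up to at most
          \<open>e1 * (v - u)\<close>.\<close>
        have "norm (measure lborel K *\<^sub>R h t - (x (Sup K) - x (Inf K))) =
          norm ((x u - x t - (u - t) *\<^sub>R g t) - (x v - x t - (v - t) *\<^sub>R g t))"
          using uv tE by (simp add: h_def algebra_simps)
        also have "\<dots> \<le> e1 * \<bar>u - t\<bar> + e1 * \<bar>v - t\<bar>"
          using norm_triangle_ineq4 * by (rule order_trans[OF _ add_mono])
        also have "\<dots> = e1 * measure lborel K"
          using uv by (simp add: algebra_simps)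
        finally show ?thesis .
      qed
      have "(\<Sum>p\<in>D - DE. norm (measure lborel (snd p) *\<^sub>R h (fst p) - (x (Sup (snd p)) - x (Inf (snd p)))))
          \<le> (\<Sum>p\<in>D - DE. e1 * measure lborel (snd p))"
        by (intro sum_mono) (use out in auto)
      also have "\<dots> \<le> (\<Sum>p\<in>D. e1 * measure lborel (snd p))"
        by (intro sum_mono2) (use finD e1 in auto)
      also have "\<dots> = e1 * (b - a)"
        using additive_content_tagged_division[of D a b] D ab
        by (simp add: sum_distrib_left[symmetric] case_prod_unfold)
      finally have sum1: "(\<Sum>p\<in>D - DE. norm (measure lborel (snd p) *\<^sub>R h (fst p) -
          (x (Sup (snd p)) - x (Inf (snd p))))) < e / 2"
        using e1_le by linarith
      \<comment> \<open>Absolute continuity speaks of families indexed by numbers, so the pieces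
        tagged in \<open>E\<close> are enumerated.\<close>
      obtain p where p: "bij_betw p {..<card DE} DE"
        using ex_bij_betw_nat_finite[OF finDE] atLeast0LessThan by auto
      define u v where "u k = Inf (snd (p k))" and "v k = Sup (snd (p k))" for k
      have pk: "snd (p k) = {u k..v k}" "a \<le> u k" "u k \<le> v k" "v k \<le> b" "{u k..v k} \<subseteq> U"
        if "k < card DE" for k
      proof -
        have "p k \<in> DE" using p that by (auto simp: bij_betw_def)
        then have "(fst (p k), snd (p k)) \<in> D" "fst (p k) \<in> E" by (auto simp: DE_def)
        from K[OF this(1)] this(2) show "snd (p k) = {u k..v k}" "a \<le> u k" "u k \<le> v k" "v k \<le> b"
          "{u k..v k} \<subseteq> U"
          by (auto simp: u_def v_def \<gamma>_def)
      qed
      have disj: "{u k<..<v k} \<inter> {u l<..<v l} = {}" if "k < card DE" "l < card DE" "k \<noteq> l" for k l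
      proof -
        have "p k \<in> D" "p l \<in> D" using p that by (auto simp: bij_betw_def DE_def)
        moreover have "p k \<noteq> p l" using p that by (auto simp: bij_betw_def inj_on_def)
        ultimately have "interior (snd (p k)) \<inter> interior (snd (p l)) = {}"
          using tagged_division_ofD(5)[OF D, of "fst (p k)" "snd (p k)" "fst (p l)" "snd (p l)"] by simp
        then show ?thesis using pk that by simp
      qed
      \<comment> \<open>The open intervals are disjoint and lie in \<open>U\<close>, so their total
        length is below the threshold \<open>d\<close> of absolute continuity.\<close>
      have "ennreal (\<Sum>k<card DE. v k - u k) = (\<Sum>k<card DE. emeasure lborel {u k<..<v k})"
        using pk by (subst sum_ennreal[symmetric]) auto
      also have "\<dots> = emeasure lborel (\<Union>k<card DE. {u k<..<v k})"
        using disj by (intro sum_emeasure) (auto simp: disjoint_family_on_def)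
      also have "\<dots> \<le> emeasure lborel U"
        using pk(5) U(1) by (intro emeasure_mono) (auto simp: subset_iff)
      also have "\<dots> < ennreal d" by (rule Ud)
      finally have "ennreal (\<Sum>k<card DE. v k - u k) < ennreal d" .
      moreover have "0 \<le> (\<Sum>k<card DE. v k - u k)"
        using pk by (intro sum_nonneg) auto
      ultimately have "(\<Sum>k<card DE. v k - u k) < d"
        by (simp only: ennreal_less_iff)
      then have "(\<Sum>k<card DE. norm (x (v k) - x (u k))) < e / 2"
        using pk disj by (intro d_ac) auto
      also have "(\<Sum>k<card DE. norm (x (v k) - x (u k))) = (\<Sum>p\<in>DE. F p)"
        unfolding u_def v_def F_def by (rule sum.reindex_bij_betw[OF p])
      also have "\<dots> = (\<Sum>p\<in>DE. norm (measure lborel (snd p) *\<^sub>R h (fst p) -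
          (x (Sup (snd p)) - x (Inf (snd p)))))"
        by (rule sum.cong) (auto simp: F_def DE_def h_def norm_minus_commute)
      finally have sum2: "(\<Sum>p\<in>DE. norm (measure lborel (snd p) *\<^sub>R h (fst p) -
          (x (Sup (snd p)) - x (Inf (snd p))))) < e / 2" .
      have "(\<Sum>(t, K)\<in>D. measure lborel K *\<^sub>R h t) - (x b - x a) =
          (\<Sum>p\<in>D. measure lborel (snd p) *\<^sub>R h (fst p) - (x (Sup (snd p)) - x (Inf (snd p))))"
        using additive_tagged_division_1[OF ab D, of x]
        by (simp add: sum_subtractf case_prod_unfold)
      then have "norm ((\<Sum>(t, K)\<in>D. measure lborel K *\<^sub>R h t) - (x b - x a)) \<le>
          (\<Sum>p\<in>D. norm (measure lborel (snd p) *\<^sub>R h (fst p) - (x (Sup (snd p)) - x (Inf (snd p)))))"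
        by (simp add: sum_norm_le)
      also have "\<dots> < e"
        using sum1 sum2 sum.subset_diff[of DE D "\<lambda>p. norm (measure lborel (snd p) *\<^sub>R h (fst p) -
          (x (Sup (snd p)) - x (Inf (snd p))))"] finD
        by (simp add: DE_def)
      finally show ?thesis .
    qed
    show "\<exists>\<gamma>. gauge \<gamma> \<and> (\<forall>D. D tagged_division_of {a..b} \<and> \<gamma> fine D \<longrightarrow>
        norm ((\<Sum>(t, K)\<in>D. measure lborel K *\<^sub>R h t) - (x b - x a)) < e)"
      by (intro exI[of _ \<gamma>] conjI allI impI gauge small) (elim conjE, assumption)+
  qed
  then show ?thesis
    by (rule has_integral_spike[OF E_neg, rotated]) (simp add: h_def)
qed

section \<open>Restriction, continuity and the Lipschitz case\<close>

lemma abs_continuous_subset: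
  assumes "abs_continuous a b x" "a \<le> c" "d \<le> b"
  shows "abs_continuous c d x"
  unfolding abs_continuous_def
proof (intro allI impI)
  fix e :: real assume "e > 0"
  with assms(1) obtain r where "r > 0" and r: "\<And>(m::nat) u v.
      \<lbrakk>\<forall>k<m. a \<le> u k \<and> u k \<le> v k \<and> v k \<le> b;
       \<forall>k<m. \<forall>l<m. k \<noteq> l \<longrightarrow> {u k<..<v k} \<inter> {u l<..<v l} = {};
       (\<Sum>k<m. v k - u k) < r\<rbrakk> \<Longrightarrow> (\<Sum>k<m. norm (x (v k) - x (u k))) < e"
    by (rule abs_continuousE) (rule that)
  show "\<exists>\<delta>>0. \<forall>(m::nat) u v.
      (\<forall>k<m. c \<le> u k \<and> u k \<le> v k \<and> v k \<le> d) \<and>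
      (\<forall>k<m. \<forall>l<m. k \<noteq> l \<longrightarrow> {u k<..<v k} \<inter> {u l<..<v l} = {}) \<and>
      (\<Sum>k<m. v k - u k) < \<delta> \<longrightarrow> (\<Sum>k<m. norm (x (v k) - x (u k))) < e"
  proof (intro exI[of _ r] conjI allI impI \<open>r > 0\<close>)
    fix m :: nat and u v
    assume H: "(\<forall>k<m. c \<le> u k \<and> u k \<le> v k \<and> v k \<le> d) \<and>
      (\<forall>k<m. \<forall>l<m. k \<noteq> l \<longrightarrow> {u k<..<v k} \<inter> {u l<..<v l} = {}) \<and> (\<Sum>k<m. v k - u k) < r"
    show "(\<Sum>k<m. norm (x (v k) - x (u k))) < e"
      by (rule r) (use H assms(2,3) in force)+
  qed
qed

lemma abs_continuous_imp_continuous_on: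
  assumes "abs_continuous a b x"
  shows "continuous_on {a..b} x"
  unfolding continuous_on_iff
proof (intro ballI allI impI)
  fix t e :: real assume t: "t \<in> {a..b}" and "e > 0"
  from assms \<open>e > 0\<close> obtain r where "r > 0" and r: "\<And>(m::nat) u v.
      \<lbrakk>\<forall>k<m. a \<le> u k \<and> u k \<le> v k \<and> v k \<le> b;
       \<forall>k<m. \<forall>l<m. k \<noteq> l \<longrightarrow> {u k<..<v k} \<inter> {u l<..<v l} = {};
       (\<Sum>k<m. v k - u k) < r\<rbrakk> \<Longrightarrow> (\<Sum>k<m. norm (x (v k) - x (u k))) < e"
    by (rule abs_continuousE) (rule that)
  \<comment> \<open>Absolute continuity is applied to the single interval between \<open>y\<close>
    and \<open>t\<close>.\<close>
  have "dist (x y) (x t) < e" if "y \<in> {a..b}" "dist y t < r" for y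
    using r[of 1 "\<lambda>_. min y t" "\<lambda>_. max y t"] that t
    by (cases "y \<le> t") (auto simp: min_def max_def dist_norm norm_minus_commute)
  with \<open>r > 0\<close> show "\<exists>d>0. \<forall>y\<in>{a..b}. dist y t < d \<longrightarrow> dist (x y) (x t) < e" by blast
qed

lemma lipschitz_on_imp_abs_continuous:
  assumes "L-lipschitz_on {a..b} x"
  shows "abs_continuous a b x"
  unfolding abs_continuous_def
proof (intro allI impI)
  fix e :: real assume "e > 0"
  have "L \<ge> 0" using assms by (rule lipschitz_on_nonneg)
  show "\<exists>\<delta>>0. \<forall>(m::nat) u v.
      (\<forall>k<m. a \<le> u k \<and> u k \<le> v k \<and> v k \<le> b) \<and>
      (\<forall>k<m. \<forall>l<m. k \<noteq> l \<longrightarrow> {u k<..<v k} \<inter> {u l<..<v l} = {}) \<and>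
      (\<Sum>k<m. v k - u k) < \<delta> \<longrightarrow> (\<Sum>k<m. norm (x (v k) - x (u k))) < e"
  \<comment> \<open>The constant \<open>L\<close> may be 0, hence the denominator
    \<open>L + 1\<close>.\<close>
  proof (intro exI[of _ "e / (L + 1)"] conjI allI impI)
    show "e / (L + 1) > 0" using \<open>e > 0\<close> \<open>L \<ge> 0\<close> by simp
    fix m :: nat and u v
    assume H: "(\<forall>k<m. a \<le> u k \<and> u k \<le> v k \<and> v k \<le> b) \<and>
      (\<forall>k<m. \<forall>l<m. k \<noteq> l \<longrightarrow> {u k<..<v k} \<inter> {u l<..<v l} = {}) \<and>
      (\<Sum>k<m. v k - u k) < e / (L + 1)"
    have "norm (x (v k) - x (u k)) \<le> L * (v k - u k)" if "k < m" for k
      using lipschitz_onD[OF assms, of "v k" "u k"] H that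
      by (force simp: dist_norm)
    then have "(\<Sum>k<m. norm (x (v k) - x (u k))) \<le> (\<Sum>k<m. L * (v k - u k))"
      by (intro sum_mono) auto
    also have "\<dots> = L * (\<Sum>k<m. v k - u k)" by (simp add: sum_distrib_left)
    also have "\<dots> \<le> L * (e / (L + 1))"
      using H \<open>L \<ge> 0\<close> by (intro mult_left_mono) auto
    also have "\<dots> < e" using \<open>e > 0\<close> \<open>L \<ge> 0\<close> by (simp add: divide_simps)
    finally show "(\<Sum>k<m. norm (x (v k) - x (u k))) < e" .
  qed
qed

text \<open>The equation is given only almost everywhere. While the mode is constant, however, the
  right-hand side is continuous along the path, so the integral form of the equation yields a
  derivative at every point, one-sided at the ends. The mode at \<open>b\<close> itself is left
  open, since a switch may occur there.\<close>

lemma is_solution_has_vector_derivative: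
  fixes x :: "real \<Rightarrow> 'a::euclidean_space"
  assumes sol: "is_solution f s x0 x" and ab: "0 \<le> a" "a < b"
    and mode: "\<And>t. a \<le> t \<Longrightarrow> t < b \<Longrightarrow> s t = i"
    and cont: "continuous_on UNIV (f i)" and t: "t \<in> {a..b}"
  shows "(x has_vector_derivative f i (x t)) (at t within {a..b})"
proof -
  have "abs_continuous 0 b x" using sol ab by (auto simp: is_solution_def)
  then have ac: "abs_continuous a b x" using ab by (auto intro: abs_continuous_subset)
  then have contx: "continuous_on {a..b} (\<lambda>t. f i (x t))"
    by (intro continuous_on_compose2[OF cont] abs_continuous_imp_continuous_on) auto
  have ae: "AE t in lborel. a < t \<and> t < b \<longrightarrow> (x has_vector_derivative f i (x t)) (at t)"
  proof -
    have "AE t in lborel. 0 < t \<longrightarrow> (x has_vector_derivative f (s t) (x t)) (at t)"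
      using sol by (simp add: is_solution_def)
    then show ?thesis
      by eventually_elim (use ab mode in \<open>auto simp: less_imp_le\<close>)
  qed
  have int: "x r = x a + integral {a..r} (\<lambda>t. f i (x t))" if r: "r \<in> {a..b}" for r
  proof -
    have "((\<lambda>t. f i (x t)) has_integral x r - x a) {a..r}"
    proof (rule abs_continuous_imp_has_integral)
      show "abs_continuous a r x" using ac r by (auto intro: abs_continuous_subset)
      show "AE t in lborel. a < t \<and> t < r \<longrightarrow> (x has_vector_derivative f i (x t)) (at t)"
        using ae by eventually_elim (use r in auto)
    qed (use r in auto)
    then show ?thesis by (simp add: integral_unique)
  qed
  have "((\<lambda>r. x a + integral {a..r} (\<lambda>t. f i (x t))) has_vector_derivative f i (x t))
      (at t within {a..b})"
    using has_vector_derivative_add[OF has_vector_derivative_const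
        integral_has_vector_derivative[OF contx t]] by simp
  then show ?thesis
    by (rule has_vector_derivative_transform[OF t, rotated]) (rule int)
qed

section \<open>Gradients and exponential decay along a curve\<close>

lemma GDERIV_gradient:
  fixes V :: "'a::euclidean_space \<Rightarrow> real"
  assumes "V differentiable (at x)"
  shows "GDERIV V x :> gradient V x"
proof -
  obtain V' where V': "(V has_derivative V') (at x)" using assms by (auto simp: differentiable_def)
  interpret bounded_linear V' using V' by (rule has_derivative_bounded_linear)
  \<comment> \<open>This is the Riesz representative of the derivative, assembled from its values on
    an orthonormal basis.\<close>
  define D where "D = (\<Sum>b\<in>Basis. V' b *\<^sub>R b)"
  have "V' h = h \<bullet> D" for h
  proof -
    have "V' h = V' (\<Sum>b\<in>Basis. (h \<bullet> b) *\<^sub>R b)" by (simp add: euclidean_representation)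
    also have "\<dots> = h \<bullet> D"
      by (simp add: D_def sum scaleR inner_sum_right mult.commute)
    finally show ?thesis .
  qed
  then have "V' = (\<lambda>h. h \<bullet> D)" by blast
  then have D: "GDERIV V x :> D"
    using V' by (simp add: gderiv_def)
  \<comment> \<open>\<open>gradient\<close> is a definite description, so uniqueness has to be shown
    along with existence.\<close>
  have "D' = D" if "GDERIV V x :> D'" for D'
  proof -
    have "(\<lambda>h. h \<bullet> D') = (\<lambda>h. h \<bullet> D)"
      using has_derivative_unique that D by (auto simp: gderiv_def)
    then have "b \<bullet> D' = b \<bullet> D" for b by meson
    then show ?thesis using vector_eq_ldot by blast
  qed
  with D show ?thesis
    unfolding gradient_def by (rule theI)
qed

text \<open>The weighted function \<open>exp (l * t) * V (y t)\<close> has nonpositive derivative.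
  The decay is required only inside the interval, which suits a solution of a truncated field that
  agrees with the original one only up to its first exit time.\<close>

lemma exp_decay_along:
  fixes V :: "'a::euclidean_space \<Rightarrow> real"
  assumes V: "\<And>x. V differentiable (at x)"
    and y: "\<And>t. t \<in> {a..b} \<Longrightarrow> (y has_vector_derivative d t) (at t within {a..b})"
    and decay: "\<And>t. a < t \<Longrightarrow> t < b \<Longrightarrow> gradient V (y t) \<bullet> d t \<le> - l * V (y t)"
    and ab: "a \<le> b"
  shows "V (y b) \<le> exp (- l * (b - a)) * V (y a)"
proof -
  define W where "W t = exp (l * t) * V (y t)" for t
  have V': "(V has_derivative (\<lambda>h. h \<bullet> gradient V x)) (at x within S)" for x S
    using GDERIV_gradient[OF V, of x] by (auto simp: gderiv_def intro: has_derivative_at_withinI)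
  have Vy: "((\<lambda>t. V (y t)) has_real_derivative d t \<bullet> gradient V (y t)) (at t within {a..b})"
    if "t \<in> {a..b}" for t
  proof -
    have "((V \<circ> y) has_derivative ((\<lambda>h. h \<bullet> gradient V (y t)) \<circ> (\<lambda>h. h *\<^sub>R d t)))
        (at t within {a..b})"
      using y[OF that] V' unfolding has_vector_derivative_def by (rule diff_chain_within)
    then show ?thesis
      by (simp add: has_field_derivative_def o_def mult_commute_abs mult.commute)
  qed
  have W': "(W has_real_derivative exp (l * t) * (l * V (y t) + d t \<bullet> gradient V (y t)))
      (at t within {a..b})" if "t \<in> {a..b}" for t
    unfolding W_def
    by (rule derivative_eq_intros Vy[OF that] refl)+ (simp add: algebra_simps)
  have "W b \<le> W a"
  proof (rule DERIV_nonpos_imp_decreasing_open[OF ab])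
    fix t assume t: "a < t" "t < b"
    have "(W has_real_derivative exp (l * t) * (l * V (y t) + d t \<bullet> gradient V (y t))) (at t)"
      using W'[of t] t by (simp add: at_within_Icc_at)
    moreover have "exp (l * t) * (l * V (y t) + d t \<bullet> gradient V (y t)) \<le> 0"
      using decay[of t] t by (simp add: mult_le_0_iff inner_commute)
    ultimately show "\<exists>z. (W has_real_derivative z) (at t) \<and> z \<le> 0" by blast
  next
    show "continuous_on {a..b} W"
      using W' by (meson DERIV_continuous continuous_on_eq_continuous_within)
  qed
  then show ?thesis
    by (simp add: W_def exp_diff exp_minus right_diff_distrib field_simps)
qed

section \<open>Existence of solutions\<close>

text \<open>\<open>P\<close> is the Picard operator conjugated with the weight \<open>exp (2 * K * t)\<close>, which makes it
  a contraction on an interval of any length.\<close>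

lemma lipschitz_ode_solution:
  fixes g :: "'a::banach \<Rightarrow> 'a"
  assumes g: "L-lipschitz_on UNIV g" and h: "0 \<le> h"
  obtains y where "y 0 = x0"
    "\<And>t. t \<in> {0..h} \<Longrightarrow> (y has_vector_derivative g (y t)) (at t within {0..h})"
proof -
  define K where "K = L + 1"
  have K: "K > 0" using lipschitz_on_nonneg[OF g] by (simp add: K_def)
  have gK: "norm (g u - g v) \<le> K * norm (u - v)" for u v
    using lipschitz_on_normD[OF g UNIV_I UNIV_I, of u v] norm_ge_zero[of "u - v"]
    unfolding K_def distrib_right by linarith
  have contg: "continuous_on UNIV g" using g by (rule lipschitz_on_continuous_on)
  \<comment> \<open>The fixed point is sought among the bounded continuous functions on the whole
    line. Clamping the time to \<open>{0..h}\<close> extends the Picard iterate to such a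
    function.\<close>
  define c where "c t = max 0 (min h t)" for t
  have c: "c t \<in> {0..h}" for t using h by (auto simp: c_def)
  have c_id: "c t = t" if "t \<in> {0..h}" for t using that by (auto simp: c_def)
  have contc: "continuous_on UNIV c" unfolding c_def by (intro continuous_intros)
  \<comment> \<open>The unknown \<open>z\<close> is the trajectory multiplied by
    \<open>exp (- (2 * K * s))\<close>, so \<open>G z\<close> is the field along the trajectory
    itself.\<close>
  define G where "G z s = g (exp (2 * K * s) *\<^sub>R apply_bcontfun z s)" for z s
  have contG: "continuous_on S (G z)" for S z
    unfolding G_def by (intro continuous_on_compose2[OF contg] continuous_intros) auto
  define F where "F z r = exp (- (2 * K * r)) *\<^sub>R (x0 + integral {0..r} (G z))" for z r
  have contF: "continuous_on {0..h} (F z)" for z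
    unfolding F_def
    by (intro continuous_intros indefinite_integral_continuous_1 integrable_continuous_real contG)
  have bc: "(\<lambda>t. F z (c t)) \<in> bcontfun" for z
  proof -
    have "continuous_on UNIV (\<lambda>t. F z (c t))"
      using c by (intro continuous_on_compose2[OF contF contc]) auto
    moreover have "bounded (F z ` {0..h})"
      by (intro compact_imp_bounded compact_continuous_image contF) auto
    then have "bounded (range (\<lambda>t. F z (c t)))"
      by (rule bounded_subset) (use c in auto)
    ultimately show ?thesis by (simp add: bcontfun_def)
  qed
  define P where "P z = Bcontfun (\<lambda>t. F z (c t))" for z
  have P: "apply_bcontfun (P z) t = F z (c t)" for z t
    using bc[of z] by (simp add: P_def Bcontfun_inverse)
  have "dist (P z) (P w) \<le> 1 / 2 * dist z w" for z w
  proof (rule dist_bound)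
    fix t
    define r where "r = c t"
    have r: "0 \<le> r" using c[of t] by (simp add: r_def)
    \<comment> \<open>The exponent \<open>2 * K\<close> against the Lipschitz constant
      \<open>K\<close> leaves the factor 1/2 in the antiderivative, which becomes the contraction
      constant.\<close>
    have int: "((\<lambda>s. K * (exp (2 * K * s) * dist z w)) has_integral
        exp (2 * K * r) * dist z w / 2 - exp (2 * K * 0) * dist z w / 2) {0..r}"
      by (rule fundamental_theorem_of_calculus[OF r])
         (auto intro!: derivative_eq_intros simp flip: has_real_derivative_iff_has_vector_derivative)
    have "norm (G z s - G w s) \<le> K * (exp (2 * K * s) * dist z w)" for s
    proof -
      have "norm (G z s - G w s) \<le> K * norm (exp (2 * K * s) *\<^sub>R (z s - w s))"
        using gK by (simp add: G_def scaleR_diff_right)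
      also have "\<dots> = K * (exp (2 * K * s) * dist (z s) (w s))" by (simp add: dist_norm)
      also have "\<dots> \<le> K * (exp (2 * K * s) * dist z w)"
        using K dist_bounded by (intro mult_left_mono) auto
      finally show ?thesis .
    qed
    then have "norm (integral {0..r} (\<lambda>s. G z s - G w s)) \<le>
        integral {0..r} (\<lambda>s. K * (exp (2 * K * s) * dist z w))"
      by (intro integral_norm_bound_integral integrable_diff integrable_continuous_real contG
          has_integral_integrable[OF int]) auto
    also have "\<dots> \<le> exp (2 * K * r) * dist z w / 2"
      using integral_unique[OF int] by simp
    also have "integral {0..r} (\<lambda>s. G z s - G w s) = integral {0..r} (G z) - integral {0..r} (G w)"
      by (intro integral_diff integrable_continuous_real contG)
    finally have *: "norm (integral {0..r} (G z) - integral {0..r} (G w)) \<le> exp (2 * K * r) * dist z w / 2" .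
    have "dist (P z t) (P w t) = exp (- (2 * K * r)) * norm (integral {0..r} (G z) - integral {0..r} (G w))"
      by (simp add: P F_def dist_norm r_def flip: scaleR_diff_right)
    also have "\<dots> \<le> exp (- (2 * K * r)) * (exp (2 * K * r) * dist z w / 2)"
      using * by (intro mult_left_mono) auto
    also have "\<dots> = 1 / 2 * dist z w" by (simp add: exp_minus)
    finally show "dist (P z t) (P w t) \<le> 1 / 2 * dist z w" .
  qed
  then obtain z where z: "P z = z"
    using banach_fix_type[of "1/2" P] by auto
  define y where "y t = exp (2 * K * t) *\<^sub>R apply_bcontfun z t" for t
  have y_eq: "y t = x0 + integral {0..t} (G z)" if t: "t \<in> {0..h}" for t
  proof -
    have "y t = exp (2 * K * t) *\<^sub>R F z t"
      using P[of z t] c_id[OF t] by (simp add: z y_def)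
    then show ?thesis by (simp add: F_def exp_minus)
  qed
  show thesis
  proof
    show "y 0 = x0" using y_eq[of 0] h by simp
    fix t assume t: "t \<in> {0..h}"
    have "((\<lambda>r. x0 + integral {0..r} (G z)) has_vector_derivative G z t) (at t within {0..h})"
      using has_vector_derivative_add[OF has_vector_derivative_const
          integral_has_vector_derivative[OF contG t]] by simp
    then have "(y has_vector_derivative G z t) (at t within {0..h})"
      by (rule has_vector_derivative_transform[OF t, rotated]) (rule y_eq)
    then show "(y has_vector_derivative g (y t)) (at t within {0..h})"
      by (simp add: G_def y_def)
  qed
qed

section \<open>Comparison functions\<close>

lemma
  assumes "class_K_inf \<alpha>"
  shows class_K_inf_strict_mono: "strict_mono_on {0..} \<alpha>"
    and class_K_inf_zero: "\<alpha> 0 = 0"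
    and class_K_inf_continuous: "continuous_on {0..} \<alpha>"
  using assms by (auto simp: class_K_inf_def class_K_def)

lemma class_K_inf_less_cancel:
  assumes "class_K_inf \<alpha>" "0 \<le> s" "0 \<le> r" "\<alpha> s < \<alpha> r"
  shows "s < r"
proof (rule ccontr)
  assume "\<not> s < r"
  then have "r = s \<or> \<alpha> r < \<alpha> s"
    using strict_mono_onD[OF class_K_inf_strict_mono[OF assms(1)], of r s] assms by force
  with assms(4) show False by auto
qed

lemma class_K_inf_mono:
  assumes "class_K_inf \<alpha>" "0 \<le> s" "s \<le> r"
  shows "\<alpha> s \<le> \<alpha> r"
  using class_K_inf_less_cancel[OF assms(1), of r s] assms by force

lemma class_K_inf_nonneg: "class_K_inf \<alpha> \<Longrightarrow> 0 \<le> s \<Longrightarrow> 0 \<le> \<alpha> s"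
  using class_K_inf_mono[of \<alpha> 0 s] class_K_inf_zero[of \<alpha>] by simp

lemma class_K_inf_pos: "class_K_inf \<alpha> \<Longrightarrow> 0 < s \<Longrightarrow> 0 < \<alpha> s"
  using strict_mono_onD[OF class_K_inf_strict_mono, of \<alpha> 0 s] class_K_inf_zero[of \<alpha>] by simp

lemma class_K_inf_unbounded:
  assumes "class_K_inf \<alpha>"
  obtains r where "r \<ge> 0" "\<alpha> r > c"
proof -
  have "\<not> bounded (\<alpha> ` {0..})" using assms by (simp add: class_K_inf_def)
  then obtain r where "r \<ge> 0" "norm (\<alpha> r) > c"
    unfolding bounded_iff by (auto simp: not_le)
  then show thesis using that class_K_inf_nonneg[OF assms] by simp
qed

text \<open>The field is made globally Lipschitz by projecting its argument to a ball of radius \<open>R\<close>, chosen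
  so large that the Lyapunov estimate keeps the solution from reaching the boundary.\<close>

lemma lyapunov_solution_exists:
  fixes f :: "'a::euclidean_space \<Rightarrow> 'a"
  assumes lip: "local_lipschitz (UNIV :: real set) UNIV (\<lambda>_. f)"
    and V: "\<And>x. V differentiable (at x)"
    and K: "class_K_inf \<alpha>" and lower: "\<And>x. \<alpha> (norm x) \<le> V x"
    and decay: "\<And>x. gradient V x \<bullet> f x \<le> - l * V x" and h: "0 \<le> h"
  obtains y where "y 0 = x0"
    "\<And>t. t \<in> {0..h} \<Longrightarrow> (y has_vector_derivative f (y t)) (at t within {0..h})"
proof -
  obtain R where R: "R \<ge> 0" "\<alpha> R > exp (\<bar>l\<bar> * h) * V x0"
    using class_K_inf_unbounded[OF K] by blast
  define B where "B = cball (0::'a) R"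
  have B: "convex B" "closed B" "B \<noteq> {}" using R by (auto simp: B_def)
  have "local_lipschitz (UNIV :: real set) B (\<lambda>_. f)"
    using lip by (rule local_lipschitz_subset) auto
  then obtain L where L: "L-lipschitz_on B f"
    using local_lipschitz_compact_implies_lipschitz[of "{0::real}" B "\<lambda>_. f"]
      local_lipschitz_subset[of UNIV B "\<lambda>_. f" "{0::real}" B]
    by (auto simp: B_def)
  define g where "g x = f (closest_point B x)" for x
  have "1-lipschitz_on UNIV (closest_point B)"
    using closest_point_lipschitz[OF B] by (auto intro: lipschitz_onI)
  then have "(L * 1)-lipschitz_on UNIV (\<lambda>x. f (closest_point B x))"
    by (rule lipschitz_on_compose2)
      (use L closest_point_in_set[OF B(2,3)] in \<open>auto intro: lipschitz_on_subset\<close>)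
  then have "L-lipschitz_on UNIV g" by (simp add: g_def[abs_def])
  then obtain y where y0: "y 0 = x0" and
    y: "\<And>t. t \<in> {0..h} \<Longrightarrow> (y has_vector_derivative g (y t)) (at t within {0..h})"
    using lipschitz_ode_solution[OF _ h] by blast
  have g_eq: "g x = f x" if "norm x \<le> R" for x
    using that by (simp add: g_def closest_point_self B_def)
  have inside: "norm (y t) < R" if t: "t \<in> {0..h}" for t
  proof (rule ccontr)
    assume "\<not> norm (y t) < R"
    \<comment> \<open>\<open>S\<close> collects the times outside the open ball. It is closed, so
      its infimum \<open>u\<close> is a genuine first exit time.\<close>
    define S where "S = {r \<in> {0..h}. R \<le> norm (y r)}"
    have "t \<in> S" using t \<open>\<not> norm (y t) < R\<close> by (auto simp: S_def)
    have "continuous_on {0..h} (\<lambda>r. norm (y r))"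
      using y by (intro continuous_on_norm continuous_on_vector_derivative)
    then have "closed ({0..h} \<inter> (\<lambda>r. norm (y r)) -` {R..})"
      by (intro continuous_closed_preimage) auto
    also have "{0..h} \<inter> (\<lambda>r. norm (y r)) -` {R..} = S" by (auto simp: S_def)
    finally have "closed S" .
    moreover have bdd: "bdd_below S" by (auto simp: S_def bdd_below_def)
    ultimately have u: "Inf S \<in> S" using \<open>t \<in> S\<close> by (intro closed_contains_Inf) auto
    define u where "u = Inf S"
    have uS: "u \<in> {0..h}" "R \<le> norm (y u)" using u by (auto simp: u_def S_def)
    have less: "norm (y r) < R" if "0 \<le> r" "r < u" for r
      using cInf_lower[OF _ bdd, of r] that uS by (force simp: S_def u_def not_less)
    \<comment> \<open>Before \<open>u\<close> the truncated field equals \<open>f\<close>, so the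
      Lyapunov estimate reaches up to \<open>u\<close>. It keeps \<open>V (y u)\<close> below
      \<open>\<alpha> R\<close>, whereas being outside the ball forces \<open>V (y u)\<close> to be
      at least \<open>\<alpha> R\<close>.\<close>
    have "V (y u) \<le> exp (- l * (u - 0)) * V (y 0)"
    proof (rule exp_decay_along[OF V])
      show "(y has_vector_derivative g (y r)) (at r within {0..u})" if "r \<in> {0..u}" for r
        using y[of r] uS that by (auto intro: has_vector_derivative_within_subset)
      show "gradient V (y r) \<bullet> g (y r) \<le> - l * V (y r)" if "0 < r" "r < u" for r
        using decay less[of r] that by (simp add: g_eq)
    qed (use uS in auto)
    also have "\<dots> \<le> exp (\<bar>l\<bar> * h) * V x0"
    proof -
      have "0 \<le> V x0" using lower[of x0] class_K_inf_nonneg[OF K norm_ge_zero[of x0]] by linarith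
      moreover have "- l * u \<le> \<bar>l\<bar> * h"
        using uS by (intro mult_mono) auto
      ultimately show ?thesis by (intro mult_mono) (auto simp: y0)
    qed
    also have "\<dots> < \<alpha> R" by (rule R)
    also have "\<dots> \<le> \<alpha> (norm (y u))" using R uS by (intro class_K_inf_mono[OF K])
    also have "\<dots> \<le> V (y u)" by (rule lower)
    finally show False by simp
  qed
  show thesis
    using y y0 inside g_eq by (intro that[of y]) (auto simp: less_imp_le)
qed

section \<open>Concatenation over the switching intervals\<close>

lemma switching_index:
  fixes \<tau> :: "nat \<Rightarrow> real"
  assumes "\<tau> 0 = 0" "\<And>i. \<tau> i < \<tau> (Suc i)" "filterlim \<tau> at_top sequentially" "0 \<le> t"
  obtains k where "\<tau> k \<le> t" "t < \<tau> (Suc k)"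
proof -
  \<comment> \<open>Divergence of \<open>\<tau>\<close> rules out an accumulation of switching
    instants before \<open>t\<close>.\<close>
  obtain n where "t < \<tau> n"
    using assms(3) unfolding filterlim_at_top_dense eventually_sequentially by blast
  define k where "k = (LEAST k. t < \<tau> k)"
  have k: "t < \<tau> k" unfolding k_def by (rule LeastI[of _ n]) fact
  with assms obtain j where j: "k = Suc j" by (cases k) auto
  then have "\<not> t < \<tau> j" using not_less_Least[of j "\<lambda>k. t < \<tau> k"] by (simp add: k_def)
  then show thesis using that[of j] k j by simp
qed

text \<open>The solutions of the single modes are placed end to end. The result is Lipschitz on each
  \<open>{0..\<tau> k}\<close>, hence absolutely continuous, and it satisfies the equation off the
  switching instants, which form a countable and thus null set.\<close>

lemma switched_solution_exists:
  fixes f :: "nat \<Rightarrow> 'a::euclidean_space \<Rightarrow> 'a"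
  assumes \<tau>: "\<tau> 0 = 0" "\<And>i. \<tau> i < \<tau> (Suc i)" "filterlim \<tau> at_top sequentially"
    and s: "\<And>i t. \<tau> i \<le> t \<Longrightarrow> t < \<tau> (Suc i) \<Longrightarrow> s t = m i"
    and cont: "\<And>i. continuous_on UNIV (f (m i))"
    and ex: "\<And>i p. \<exists>y. y 0 = p \<and> (\<forall>t\<in>{0..\<tau> (Suc i) - \<tau> i}.
      (y has_vector_derivative f (m i) (y t)) (at t within {0..\<tau> (Suc i) - \<tau> i}))"
  shows "\<exists>x. is_solution f s x0 x"
proof -
  obtain Y where Y0: "\<And>i p. Y i p 0 = p" and
    Y: "\<And>i p t. t \<in> {0..\<tau> (Suc i) - \<tau> i} \<Longrightarrow>
      (Y i p has_vector_derivative f (m i) (Y i p t)) (at t within {0..\<tau> (Suc i) - \<tau> i})"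
  proof -
    define Y where "Y i p = (SOME y. y 0 = p \<and> (\<forall>t\<in>{0..\<tau> (Suc i) - \<tau> i}.
      (y has_vector_derivative f (m i) (y t)) (at t within {0..\<tau> (Suc i) - \<tau> i})))" for i p
    show thesis
      by (rule that[of Y]) (use someI_ex[OF ex, folded Y_def] in blast)+
  qed
  \<comment> \<open>\<open>X i\<close> is the state at the instant \<open>\<tau> i\<close>, that is,
    the end value of the previous piece.\<close>
  define X where "X = rec_nat x0 (\<lambda>i p. Y i p (\<tau> (Suc i) - \<tau> i))"
  have X: "X 0 = x0" "X (Suc i) = Y i (X i) (\<tau> (Suc i) - \<tau> i)" for i
    by (simp_all add: X_def)
  have mono: "strict_mono \<tau>" using \<tau>(2) by (simp add: strict_mono_Suc_iff)
  have \<tau>_nonneg: "0 \<le> \<tau> i" for i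
    using \<tau>(1) monoD[OF strict_mono_mono[OF mono], of 0 i] by simp
  define \<kappa> where "\<kappa> t = (THE k. \<tau> k \<le> t \<and> t < \<tau> (Suc k))" for t
  have \<kappa>: "\<kappa> t = k" if "\<tau> k \<le> t" "t < \<tau> (Suc k)" for t k
    unfolding \<kappa>_def
  proof (rule the_equality)
    fix j assume j: "\<tau> j \<le> t \<and> t < \<tau> (Suc j)"
    then have "\<tau> j < \<tau> (Suc k)" "\<tau> k < \<tau> (Suc j)" using that by linarith+
    then show "j = k" using strict_mono_less[OF mono] by (metis less_Suc_eq_le le_antisym)
  qed (use that in auto)
  define x where "x t = Y (\<kappa> t) (X (\<kappa> t)) (t - \<tau> (\<kappa> t))" for t
  have x_eq: "x t = Y k (X k) (t - \<tau> k)" if "t \<in> {\<tau> k..\<tau> (Suc k)}" for t k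
  proof (cases "t = \<tau> (Suc k)")
    case True
    \<comment> \<open>At the right endpoint \<open>x\<close> is already given by the next piece,
      whose initial value is the end value of the current one; hence the formula also holds on the
      closed interval.\<close>
    then have "\<kappa> t = Suc k" using \<tau>(2) by (intro \<kappa>) auto
    then show ?thesis using True by (simp add: x_def X Y0)
  next
    case False
    then show ?thesis using \<kappa>[of k t] that by (simp add: x_def)
  qed
  have x_der: "(x has_vector_derivative f (m k) (x t)) (at t within {\<tau> k..\<tau> (Suc k)})"
    if t: "t \<in> {\<tau> k..\<tau> (Suc k)}" for t k
  proof -
    have "(Y k (X k) has_vector_derivative f (m k) (x t))
        (at (t - \<tau> k) within (\<lambda>t. t - \<tau> k) ` {\<tau> k..\<tau> (Suc k)})"
      using Y[of "t - \<tau> k" k "X k"] t x_eq[OF t] by (simp add: image_diff_atLeastAtMost)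
    moreover have "((\<lambda>t. t - \<tau> k) has_vector_derivative 1) (at t within {\<tau> k..\<tau> (Suc k)})"
      by (auto intro!: derivative_eq_intros)
    ultimately have "((Y k (X k) \<circ> (\<lambda>t. t - \<tau> k)) has_vector_derivative 1 *\<^sub>R f (m k) (x t))
        (at t within {\<tau> k..\<tau> (Suc k)})"
      by (intro vector_diff_chain_within)
    then show ?thesis
      by (intro has_vector_derivative_transform[OF t x_eq]) (simp_all add: o_def)
  qed
  have lip1: "\<exists>L. L-lipschitz_on {\<tau> k..\<tau> (Suc k)} x" for k
  proof -
    have "continuous_on {\<tau> k..\<tau> (Suc k)} x"
      using x_der by (rule continuous_on_vector_derivative)
    then have "bounded ((\<lambda>t. f (m k) (x t)) ` {\<tau> k..\<tau> (Suc k)})"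
      by (intro compact_imp_bounded compact_continuous_image continuous_on_compose2[OF cont]) auto
    then obtain L where L: "L > 0" "\<And>t. t \<in> {\<tau> k..\<tau> (Suc k)} \<Longrightarrow> norm (f (m k) (x t)) \<le> L"
      unfolding bounded_pos by auto
    have "L-lipschitz_on {\<tau> k..\<tau> (Suc k)} x"
    proof (rule bounded_derivative_imp_lipschitz)
      show "(x has_derivative (\<lambda>h. h *\<^sub>R f (m k) (x t))) (at t within {\<tau> k..\<tau> (Suc k)})"
        if "t \<in> {\<tau> k..\<tau> (Suc k)}" for t
        using x_der[OF that] by (simp add: has_vector_derivative_def)
      show "onorm (\<lambda>h. h *\<^sub>R f (m k) (x t)) \<le> L" if "t \<in> {\<tau> k..\<tau> (Suc k)}" for t
        using L(2)[OF that] by (simp add: onorm_scaleR_left onorm_id)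
    qed (use L in auto)
    then show ?thesis by blast
  qed
  have lip: "\<exists>L. L-lipschitz_on {0..\<tau> k} x" for k
  proof (induction k)
    case 0
    then show ?case by (intro exI[of _ 0]) (simp add: \<tau> lipschitz_on_singleton)
  next
    case (Suc k)
    obtain L M where "L-lipschitz_on {0..\<tau> k} x" "M-lipschitz_on {\<tau> k..\<tau> (Suc k)} x"
      using Suc lip1 by blast
    from lipschitz_on_concat_max[OF this refl] show ?case by auto
  qed
  have "is_solution f s x0 x"
    unfolding is_solution_def
  proof (intro conjI allI impI)
    show "x 0 = x0"
      using x_eq[of 0 0] \<tau>(2)[of 0] by (simp add: \<tau>(1) X Y0)
    show "abs_continuous 0 b x" if b: "b > 0" for b
    proof -
      have "0 \<le> b" using b by simp
      then obtain k where "\<tau> k \<le> b" "b < \<tau> (Suc k)"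
        by (rule switching_index[OF \<tau>])
      then show ?thesis
        using lip[of "Suc k"] by (auto intro: abs_continuous_subset lipschitz_on_imp_abs_continuous)
    qed
    have "range \<tau> \<in> null_sets lborel" by (intro countable_imp_null_set_lborel) auto
    then have "AE t in lborel. t \<notin> range \<tau>" by (rule AE_not_in)
    then show "AE t in lborel. 0 < t \<longrightarrow> (x has_vector_derivative f (s t) (x t)) (at t)"
    proof eventually_elim
      case (elim t)
      show ?case
      proof
        assume "0 < t"
        then have "0 \<le> t" by simp
        then obtain k where k: "\<tau> k \<le> t" "t < \<tau> (Suc k)"
          by (rule switching_index[OF \<tau>])
        then have "\<tau> k < t" using elim by (metis order_le_less rangeI)
        then show "(x has_vector_derivative f (s t) (x t)) (at t)"
          using x_der[of t k] k s[OF k] by (simp add: at_within_Icc_at)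
      qed
    qed
  qed
  then show ?thesis by blast
qed

section \<open>Random products\<close>

lemma uniform_ratio_nonneg:
  assumes "T > 0" shows "uniform_ratio T l \<ge> 0"
proof (cases "l > 0")
  case True then show ?thesis using assms by (simp add: uniform_ratio_def)
next
  case False
  then have "exp (- l * T) \<ge> 1" using assms by (simp add: mult_nonpos_nonneg)
  then show ?thesis using assms False by (simp add: uniform_ratio_def divide_nonpos_nonpos mult_nonpos_nonneg)
qed

lemma uniform_ratio_less_1:
  assumes "T > 0" "l > 0" shows "uniform_ratio T l < 1"
  using exp_minus_greater[of "l * T"] assms by (simp add: uniform_ratio_def)

lemma nn_integral_exp_uniform:
  assumes "T > 0" "c \<ge> 0"
  shows "(\<integral>\<^sup>+s. ennreal (c * exp (- l * s)) \<partial>uniform_measure lborel {0..T}) =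
    ennreal (c * uniform_ratio T l)"
proof -
  have int: "(\<integral>\<^sup>+s. ennreal (c * exp (- l * s)) * indicator {0..T} s \<partial>lborel) =
      ennreal (c * (uniform_ratio T l * T))"
  \<comment> \<open>The antiderivative for \<open>l \<noteq> 0\<close> divides by \<open>l\<close>;
    at 0 the integrand is the constant \<open>c\<close>.\<close>
  proof (cases "l = 0")
    case True
    then show ?thesis using assms
      by (simp add: uniform_ratio_def nn_integral_cmult ennreal_mult)
  next
    case False
    have "(\<integral>\<^sup>+s. ennreal (c * exp (- l * s)) * indicator {0..T} s \<partial>lborel) =
        ennreal ((- c / l) * exp (- l * T) - (- c / l) * exp (- l * 0))"
      using assms False
      by (intro nn_integral_FTC_Icc[where F = "\<lambda>s. (- c / l) * exp (- l * s)"])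
        (auto intro!: derivative_eq_intros)
    also have "(- c / l) * exp (- l * T) - (- c / l) * exp (- l * 0) = c * (uniform_ratio T l * T)"
      using False assms by (simp add: uniform_ratio_def field_simps)
    finally show ?thesis .
  qed
  have "(\<integral>\<^sup>+s. ennreal (c * exp (- l * s)) \<partial>uniform_measure lborel {0..T}) =
      (\<integral>\<^sup>+s. ennreal (c * exp (- l * s)) * indicator {0..T} s \<partial>lborel) / emeasure lborel {0..T}"
    using assms by (intro nn_integral_uniform_measure) auto
  also have "\<dots> = ennreal (c * (uniform_ratio T l * T)) / ennreal T"
    unfolding int using assms by simp
  also have "\<dots> = ennreal (c * uniform_ratio T l)"
    using assms uniform_ratio_nonneg[of T l] by (subst divide_ennreal) auto
  finally show ?thesis .
qed

section \<open>Expectations of products over modes and holding times\<close>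

lemma mode_measurable:
  assumes "prob_space M" "class_UH M N \<sigma> \<tau> T q"
  shows "mode \<sigma> \<tau> k \<in> measurable M (count_space UNIV)"
proof -
  interpret prob_space M by fact
  \<comment> \<open>\<open>mode\<close> evaluates the signal at a random time, whereas
    \<open>switching_signal\<close> gives measurability at fixed times only. It is therefore read
    off from (UH3), where the modes are embedded in the reals, and pulled back by the floor.\<close>
  have "(\<lambda>\<omega> k. real (mode \<sigma> \<tau> k \<omega>)) \<in> measurable M (\<Pi>\<^sub>M k\<in>UNIV. count_space UNIV)"
    using assms(2) by (auto simp: class_UH_def dest: indep_var_rv2)
  from measurable_compose[OF this measurable_component_singleton[of k]]
  have "(\<lambda>\<omega>. real (mode \<sigma> \<tau> k \<omega>)) \<in> measurable M (count_space UNIV)" by simp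
  from measurable_compose[OF this, of "\<lambda>x. nat \<lfloor>x\<rfloor>" "count_space UNIV"] show ?thesis by simp
qed

text \<open>For each \<open>t \<ge> 0\<close> the signal has values in \<open>{1..N}\<close> at
  every sample point, so a random time creates no further exceptional set: almost surely all
  \<open>\<tau> k\<close> are nonnegative, and that suffices.\<close>

lemma mode_range:
  assumes "switching_signal M N \<sigma> \<sigma>0 \<tau>"
  shows "AE \<omega> in M. \<forall>k. mode \<sigma> \<tau> k \<omega> \<in> {1..N}"
proof -
  have "AE \<omega> in M. \<tau> 0 \<omega> = 0 \<and> (\<forall>i. \<tau> i \<omega> < \<tau> (Suc i) \<omega>)"
    using assms by (simp add: switching_signal_def)
  with AE_space show ?thesis
  proof eventually_elim
    case (elim \<omega>)
    then have "strict_mono (\<lambda>i. \<tau> i \<omega>)" by (simp add: strict_mono_Suc_iff)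
    then have "0 \<le> \<tau> k \<omega>" for k
      using elim monoD[OF strict_mono_mono, of "\<lambda>i. \<tau> i \<omega>" 0 k] by simp
    then have "\<sigma> (\<tau> k \<omega>) \<in> measurable M (count_space {1..N})" for k
      using assms by (simp add: switching_signal_def)
    from measurable_space[OF this elim(1)] show ?case by (simp add: mode_def)
  qed
qed

text \<open>The product of the first \<open>k\<close> factors is measurable with respect to the mode
  history, so it can be pulled out of the conditional expectation, and (UH2) turns the indicator of
  \<open>mode \<sigma> \<tau> k \<omega> = i\<close> into \<open>q i\<close>. The case
  \<open>k = 0\<close> is excluded because the initial mode is prescribed and does not follow
  \<open>q\<close>. Vanishing outside \<open>{1..N}\<close> makes \<open>\<phi>\<close> bounded and
  lets the last factor be expanded at every sample point.\<close>

lemma expectation_mode_product: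
  assumes prob: "prob_space M" and sig: "switching_signal M N \<sigma> \<sigma>0 \<tau>"
    and UH: "class_UH M N \<sigma> \<tau> T q" and k: "k \<ge> 1"
    and \<phi>: "\<And>i. i \<notin> {1..N} \<Longrightarrow> \<phi> i = 0"
  shows "(\<integral>\<omega>. (\<Prod>j<Suc k. \<phi> (mode \<sigma> \<tau> j \<omega>)) \<partial>M) =
    (\<Sum>i\<in>{1..N}. q i * \<phi> i) * (\<integral>\<omega>. (\<Prod>j<k. \<phi> (mode \<sigma> \<tau> j \<omega>)) \<partial>M)"
proof -
  interpret prob_space M by fact
  note mode_measurable[OF prob UH, measurable]
  define H where "H = mode_history M \<sigma> \<tau> k"
  define f where "f = (\<lambda>\<omega>. \<lambda>j\<in>{0..<k}. mode \<sigma> \<tau> j \<omega>)"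
  define P where "P = (\<Pi>\<^sub>M j\<in>{0..<k}. count_space (UNIV :: nat set))"
  have f: "f \<in> measurable M P"
    unfolding f_def P_def by (intro measurable_restrict) simp
  have H: "H = vimage_algebra (space M) f P"
    by (simp add: H_def mode_history_def f_def P_def)
  have "subalgebra M H"
    unfolding subalgebra_def H by (simp add: sets_image_in_sets[OF refl f])
  then interpret finite_measure_subalgebra M H by unfold_locales
  define \<Phi> where "\<Phi> \<omega> = (\<Prod>j<k. \<phi> (mode \<sigma> \<tau> j \<omega>))" for \<omega>
  have \<Phi>_H: "\<Phi> \<in> borel_measurable H"
  proof -
    have "f \<in> measurable H P"
      unfolding H using measurable_space[OF f] by (intro measurable_vimage_algebra1) auto
    moreover have "(\<lambda>m. \<Prod>j<k. \<phi> (m j)) \<in> borel_measurable P"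
    proof (rule borel_measurable_prod)
      fix j assume "j \<in> {..<k}"
      then have "(\<lambda>m. m j) \<in> measurable P (count_space UNIV)"
        unfolding P_def by (intro measurable_component_singleton) auto
      then show "(\<lambda>m. \<phi> (m j)) \<in> borel_measurable P"
        by (rule measurable_compose) simp
    qed
    ultimately have "(\<lambda>\<omega>. \<Prod>j<k. \<phi> (f \<omega> j)) \<in> borel_measurable H" by measurable
    also have "(\<lambda>\<omega>. \<Prod>j<k. \<phi> (f \<omega> j)) = \<Phi>"
      by (auto simp: \<Phi>_def f_def fun_eq_iff)
    finally show ?thesis .
  qed
  have \<Phi>_M[measurable]: "\<Phi> \<in> borel_measurable M"
    unfolding \<Phi>_def by measurable
  \<comment> \<open>The bound \<open>b ^ k\<close> on the partial product secures
    integrability.\<close>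
  define b where "b = (\<Sum>i\<in>{1..N}. \<bar>\<phi> i\<bar>)"
  have b: "\<bar>\<phi> i\<bar> \<le> b" for i
    using \<phi>[of i] by (cases "i \<in> {1..N}") (auto simp: b_def intro: member_le_sum sum_nonneg)
  have \<Phi>_bound: "\<bar>\<Phi> \<omega>\<bar> \<le> b ^ k" for \<omega>
    unfolding \<Phi>_def abs_prod using prod_mono[of "{..<k}" "\<lambda>j. \<bar>\<phi> (mode \<sigma> \<tau> j \<omega>)\<bar>" "\<lambda>_. b"] b by simp
  define A where "A i = {\<omega> \<in> space M. mode \<sigma> \<tau> k \<omega> = i}" for i
  have A[measurable]: "A i \<in> sets M" for i unfolding A_def by measurable
  have int: "integrable M (\<lambda>\<omega>. \<Phi> \<omega> * indicator (A i) \<omega>)" for i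
    using \<Phi>_bound by (intro integrable_const_bound[where B = "b ^ k"])
      (auto simp: indicator_def intro: order_trans[OF abs_ge_zero])
  have E: "(\<integral>\<omega>. \<Phi> \<omega> * indicator (A i) \<omega> \<partial>M) = q i * (\<integral>\<omega>. \<Phi> \<omega> \<partial>M)" if "i \<in> {1..N}" for i
  proof -
    have "(\<integral>\<omega>. \<Phi> \<omega> * indicator (A i) \<omega> \<partial>M) =
        (\<integral>\<omega>. \<Phi> \<omega> * real_cond_exp M H (indicator (A i)) \<omega> \<partial>M)"
      by (rule real_cond_exp_intg(2)[symmetric, OF int \<Phi>_H]) simp
    also have "\<dots> = (\<integral>\<omega>. \<Phi> \<omega> * q i \<partial>M)"
    proof (rule integral_cong_AE)
      have "AE \<omega> in M. real_cond_exp M H (indicator (A i)) \<omega> = q i"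
        using UH k that unfolding class_UH_def H_def A_def by blast
      then show "AE \<omega> in M. \<Phi> \<omega> * real_cond_exp M H (indicator (A i)) \<omega> = \<Phi> \<omega> * q i"
        by eventually_elim simp
    qed simp_all
    finally show ?thesis by simp
  qed
  have "(\<integral>\<omega>. (\<Prod>j<Suc k. \<phi> (mode \<sigma> \<tau> j \<omega>)) \<partial>M) =
      (\<integral>\<omega>. (\<Sum>i\<in>{1..N}. \<phi> i * (\<Phi> \<omega> * indicator (A i) \<omega>)) \<partial>M)"
  proof (rule Bochner_Integration.integral_cong[OF refl])
    fix \<omega> assume "\<omega> \<in> space M"
    then have "(\<Sum>i\<in>{1..N}. \<phi> i * (\<Phi> \<omega> * indicator (A i) \<omega>)) =
        (\<Sum>i\<in>{1..N}. if mode \<sigma> \<tau> k \<omega> = i then \<phi> i * \<Phi> \<omega> else 0)"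
      by (intro sum.cong) (auto simp: A_def indicator_def)
    also have "\<dots> = \<phi> (mode \<sigma> \<tau> k \<omega>) * \<Phi> \<omega>"
      using \<phi>[of "mode \<sigma> \<tau> k \<omega>"] by (subst sum.delta') auto
    finally show "(\<Prod>j<Suc k. \<phi> (mode \<sigma> \<tau> j \<omega>)) = (\<Sum>i\<in>{1..N}. \<phi> i * (\<Phi> \<omega> * indicator (A i) \<omega>))"
      by (simp add: \<Phi>_def mult.commute)
  qed
  also have "\<dots> = (\<Sum>i\<in>{1..N}. \<phi> i * (\<integral>\<omega>. \<Phi> \<omega> * indicator (A i) \<omega> \<partial>M))"
    using int by (subst Bochner_Integration.integral_sum) auto
  also have "\<dots> = (\<Sum>i\<in>{1..N}. q i * \<phi> i * (\<integral>\<omega>. \<Phi> \<omega> \<partial>M))"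
    by (intro sum.cong) (auto simp: E)
  finally show ?thesis by (simp add: \<Phi>_def sum_distrib_right)
qed

text \<open>By (UH3) the joint law of holding times and modes is a product measure, so Tonelli's
  theorem allows the holding times to be integrated out with the modes frozen. By (UH1) that inner
  integral factorises, each factor being a Laplace transform of the uniform distribution.\<close>

lemma expectation_decay_product:
  assumes prob: "prob_space M" and UH: "class_UH M N \<sigma> \<tau> T q" and c: "c \<ge> 0"
  shows "(\<integral>\<^sup>+\<omega>. (\<Prod>j<k. ennreal (c * exp (- lam (mode \<sigma> \<tau> j \<omega>) * holding_time \<tau> (Suc j) \<omega>))) \<partial>M) =
    (\<integral>\<^sup>+\<omega>. (\<Prod>j<k. ennreal (c * uniform_ratio T (lam (mode \<sigma> \<tau> j \<omega>)))) \<partial>M)"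
proof -
  interpret prob_space M by fact
  define PS where "PS = (\<Pi>\<^sub>M i\<in>{1::nat..}. (borel :: real measure))"
  \<comment> \<open>\<open>indep_var\<close> relates two variables of the same type, so (UH3) embeds the modes into the reals.\<close>
  define PM where "PM = (\<Pi>\<^sub>M k\<in>(UNIV :: nat set). count_space (UNIV :: real set))"
  define X where "X = (\<lambda>\<omega>. \<lambda>i\<in>{1..}. holding_time \<tau> i \<omega>)"
  define Y where "Y = (\<lambda>\<omega> k. real (mode \<sigma> \<tau> k \<omega>))"
  define l where "l x = lam (nat \<lfloor>x :: real\<rfloor>)" for x
  have T: "T > 0" and indep: "indep_vars (\<lambda>_. borel) (holding_time \<tau>) {1..}"
    and unif: "\<And>i. i \<ge> 1 \<Longrightarrow> distr M lborel (holding_time \<tau> i) = uniform_measure lborel {0..T}"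
    and "indep_var PS X PM Y"
    using UH unfolding class_UH_def PS_def PM_def X_def Y_def by auto
  then have X[measurable]: "X \<in> measurable M PS" and Y[measurable]: "Y \<in> measurable M PM"
    and prod: "distr M PS X \<Otimes>\<^sub>M distr M PM Y = distr M (PS \<Otimes>\<^sub>M PM) (\<lambda>\<omega>. (X \<omega>, Y \<omega>))"
    unfolding indep_var_distribution_eq by auto
  interpret DX: prob_space "distr M PS X" by (rule prob_space_distr) (rule X)
  interpret DY: prob_space "distr M PM Y" by (rule prob_space_distr) (rule Y)
  interpret DXY: pair_sigma_finite "distr M PS X" "distr M PM Y" ..
  have S[measurable]: "holding_time \<tau> i \<in> borel_measurable M" if "i \<ge> 1" for i
    using indep that by (auto simp: indep_vars_def)
  have PS[measurable]: "(\<lambda>s. s (Suc j)) \<in> borel_measurable PS" for j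
    unfolding PS_def by (rule measurable_component_singleton) simp
  have PM[measurable]: "(\<lambda>m. m j) \<in> measurable PM (count_space UNIV)" for j
    unfolding PM_def by (rule measurable_component_singleton) simp
  define F where "F = (\<lambda>(s, m). \<Prod>j<k. ennreal (c * exp (- l (m j) * s (Suc j))))"
  have F[measurable]: "F \<in> borel_measurable (PS \<Otimes>\<^sub>M PM)"
  proof -
    have [measurable]: "(\<lambda>p. fst p (Suc j)) \<in> borel_measurable (PS \<Otimes>\<^sub>M PM)" for j
      by (rule measurable_compose[OF measurable_fst PS])
    have [measurable]: "(\<lambda>p. l (snd p j)) \<in> borel_measurable (PS \<Otimes>\<^sub>M PM)" for j
      by (rule measurable_compose[OF measurable_snd measurable_compose[OF PM]]) simp
    show ?thesis
      unfolding F_def case_prod_beta by measurable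
  qed
  have inner: "(\<integral>\<^sup>+s. F (s, m) \<partial>distr M PS X) = (\<Prod>j<k. ennreal (c * uniform_ratio T (l (m j))))"
    if "m \<in> space PM" for m
  proof -
    have "(\<integral>\<^sup>+s. F (s, m) \<partial>distr M PS X) = (\<integral>\<^sup>+\<omega>. F (X \<omega>, m) \<partial>M)"
      using that by (intro nn_integral_distr) measurable
    \<comment> \<open>Factor \<open>j\<close> carries holding time \<open>j + 1\<close>; the shift
      to \<open>{1..k}\<close> matches the index set of the independent family.\<close>
    also have "\<dots> = (\<integral>\<^sup>+\<omega>. (\<Prod>i\<in>{1..k}. ennreal (c * exp (- l (m (i - 1)) * holding_time \<tau> i \<omega>))) \<partial>M)"
      by (simp add: F_def X_def prod.atLeast1_atMost_eq)
    also have "\<dots> = (\<Prod>i\<in>{1..k}. \<integral>\<^sup>+\<omega>. ennreal (c * exp (- l (m (i - 1)) * holding_time \<tau> i \<omega>)) \<partial>M)"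
      by (intro indep_vars_nn_integral indep_vars_compose2[OF indep_vars_subset[OF indep]]) auto
    also have "\<dots> = (\<Prod>i\<in>{1..k}. ennreal (c * uniform_ratio T (l (m (i - 1)))))"
    proof (intro prod.cong refl)
      fix i assume "i \<in> {1..k}"
      then have i: "i \<ge> 1" by simp
      have "(\<integral>\<^sup>+\<omega>. ennreal (c * exp (- l (m (i - 1)) * holding_time \<tau> i \<omega>)) \<partial>M) =
          (\<integral>\<^sup>+s. ennreal (c * exp (- l (m (i - 1)) * s)) \<partial>distr M lborel (holding_time \<tau> i))"
        using S[OF i] by (subst nn_integral_distr) auto
      then show "(\<integral>\<^sup>+\<omega>. ennreal (c * exp (- l (m (i - 1)) * holding_time \<tau> i \<omega>)) \<partial>M) =
          ennreal (c * uniform_ratio T (l (m (i - 1))))"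
        by (simp only: unif[OF i] nn_integral_exp_uniform[OF T c])
    qed
    finally show ?thesis by (simp add: prod.atLeast1_atMost_eq)
  qed
  have "(\<integral>\<^sup>+\<omega>. (\<Prod>j<k. ennreal (c * exp (- lam (mode \<sigma> \<tau> j \<omega>) * holding_time \<tau> (Suc j) \<omega>))) \<partial>M) =
      (\<integral>\<^sup>+\<omega>. F (X \<omega>, Y \<omega>) \<partial>M)"
    by (simp add: F_def X_def Y_def l_def)
  also have "\<dots> = (\<integral>\<^sup>+p. F p \<partial>distr M (PS \<Otimes>\<^sub>M PM) (\<lambda>\<omega>. (X \<omega>, Y \<omega>)))"
    by (subst nn_integral_distr) auto
  also have "\<dots> = (\<integral>\<^sup>+m. \<integral>\<^sup>+s. F (s, m) \<partial>distr M PS X \<partial>distr M PM Y)"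
    unfolding prod[symmetric] by (rule DXY.nn_integral_snd[symmetric]) simp
  also have "\<dots> = (\<integral>\<^sup>+m. (\<Prod>j<k. ennreal (c * uniform_ratio T (l (m j)))) \<partial>distr M PM Y)"
    by (intro nn_integral_cong inner) simp
  also have "\<dots> = (\<integral>\<^sup>+\<omega>. (\<Prod>j<k. ennreal (c * uniform_ratio T (l (Y \<omega> j)))) \<partial>M)"
  proof -
    have [measurable]: "(\<lambda>m. uniform_ratio T (l (m j))) \<in> borel_measurable PM" for j
      by (rule measurable_compose[OF PM]) simp
    show ?thesis by (intro nn_integral_distr) measurable
  qed
  finally show ?thesis by (simp add: Y_def l_def)
qed

text \<open>\<open>c\<close> and \<open>lam\<close> are kept general because the result is applied
  twice: to the Lyapunov products with \<open>c = \<mu>\<close>, and to the switching instants with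
  \<open>c\<close> and all rates equal to 1.\<close>

lemma decay_product_tendsto_0:
  assumes prob: "prob_space M" and sig: "switching_signal M N \<sigma> \<sigma>0 \<tau>"
    and UH: "class_UH M N \<sigma> \<tau> T q" and c: "c \<ge> 0"
    and contr: "(\<Sum>i\<in>{1..N}. c * q i * uniform_ratio T (lam i)) < 1"
  shows "AE \<omega> in M. (\<lambda>k. \<Prod>j<k. c * exp (- lam (mode \<sigma> \<tau> j \<omega>) * holding_time \<tau> (Suc j) \<omega>)) \<longlonglongrightarrow> 0"
proof -
  interpret prob_space M by fact
  note mode_measurable[OF prob UH, measurable]
  have T: "T > 0" and indep: "indep_vars (\<lambda>_. borel) (holding_time \<tau>) {1..}"
    and q: "\<And>i. i \<in> {1..N} \<Longrightarrow> 0 \<le> q i"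
    using UH unfolding class_UH_def by auto
  have S[measurable]: "holding_time \<tau> (Suc j) \<in> borel_measurable M" for j
    using indep by (auto simp: indep_vars_def)
  \<comment> \<open>Cutting off outside \<open>{1..N}\<close> changes the products only on a null
    set, by \<open>mode_range\<close>, and gives the bounded function needed for
    \<open>expectation_mode_product\<close>.\<close>
  define \<phi> where "\<phi> i = (if i \<in> {1..N} then c * uniform_ratio T (lam i) else 0)" for i
  define \<rho> where "\<rho> = (\<Sum>i\<in>{1..N}. q i * \<phi> i)"
  have \<rho>1: "\<rho> < 1"
    using contr by (simp add: \<rho>_def \<phi>_def mult_ac)
  have \<phi>0: "\<phi> i \<ge> 0" for i
    using c uniform_ratio_nonneg[OF T] by (simp add: \<phi>_def)
  have \<rho>0: "\<rho> \<ge> 0" unfolding \<rho>_def by (intro sum_nonneg mult_nonneg_nonneg q \<phi>0)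
  define E where "E k = (\<integral>\<omega>. (\<Prod>j<k. \<phi> (mode \<sigma> \<tau> j \<omega>)) \<partial>M)" for k
  \<comment> \<open>The recursion starts from one factor: the initial mode is not distributed
    according to \<open>q\<close>, so its contribution remains as the constant
    \<open>E 1\<close>.\<close>
  have E: "E (Suc k) = \<rho> ^ k * E 1" for k
  proof (induction k)
    case (Suc k)
    have "E (Suc (Suc k)) = \<rho> * E (Suc k)"
      unfolding E_def \<rho>_def by (rule expectation_mode_product[OF prob sig UH]) (auto simp: \<phi>_def)
    then show ?case using Suc by simp
  qed simp
  have E0: "E 1 \<ge> 0" unfolding E_def by (intro Bochner_Integration.integral_nonneg prod_nonneg ballI \<phi>0)
  define Z where "Z k \<omega> = (\<Prod>j<k. c * exp (- lam (mode \<sigma> \<tau> j \<omega>) * holding_time \<tau> (Suc j) \<omega>))" for k \<omega>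
  have Z0: "Z k \<omega> \<ge> 0" for k \<omega> unfolding Z_def using c by (intro prod_nonneg) auto
  have Z_meas[measurable]: "Z k \<in> borel_measurable M" for k
    unfolding Z_def by measurable
  have EZ: "(\<integral>\<^sup>+\<omega>. ennreal (Z (Suc k) \<omega>) \<partial>M) = ennreal (\<rho> ^ k * E 1)" for k
  proof -
    define b where "b = (\<Sum>i\<in>{1..N}. \<phi> i)"
    have b: "\<phi> i \<le> b" for i
    proof (cases "i \<in> {1..N}")
      case True
      then show ?thesis unfolding b_def by (intro member_le_sum \<phi>0) auto
    next
      case False
      then have "\<phi> i = 0" by (simp only: \<phi>_def if_False)
      then show ?thesis by (simp add: b_def sum_nonneg \<phi>0)
    qed
    have "(\<integral>\<^sup>+\<omega>. ennreal (Z (Suc k) \<omega>) \<partial>M) =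
        (\<integral>\<^sup>+\<omega>. (\<Prod>j<Suc k. ennreal (c * uniform_ratio T (lam (mode \<sigma> \<tau> j \<omega>)))) \<partial>M)"
      using expectation_decay_product[OF prob UH c, where k = "Suc k" and lam = lam] c
      by (simp add: Z_def prod_ennreal del: prod.lessThan_Suc)
    also have "\<dots> = (\<integral>\<^sup>+\<omega>. ennreal (\<Prod>j<Suc k. \<phi> (mode \<sigma> \<tau> j \<omega>)) \<partial>M)"
    proof (rule nn_integral_cong_AE)
      show "AE \<omega> in M. (\<Prod>j<Suc k. ennreal (c * uniform_ratio T (lam (mode \<sigma> \<tau> j \<omega>)))) =
          ennreal (\<Prod>j<Suc k. \<phi> (mode \<sigma> \<tau> j \<omega>))"
        using mode_range[OF sig]
      proof eventually_elim
        case (elim \<omega>)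
        then have "c * uniform_ratio T (lam (mode \<sigma> \<tau> j \<omega>)) = \<phi> (mode \<sigma> \<tau> j \<omega>)" for j
          by (simp add: \<phi>_def)
        then show ?case using \<phi>0 by (simp add: prod_ennreal del: prod.lessThan_Suc)
      qed
    qed
    also have "\<dots> = ennreal (E (Suc k))"
      unfolding E_def
    proof (rule nn_integral_eq_integral)
      show "integrable M (\<lambda>\<omega>. \<Prod>j<Suc k. \<phi> (mode \<sigma> \<tau> j \<omega>))"
      proof (rule integrable_const_bound[where B = "b ^ Suc k"])
        show "AE \<omega> in M. norm (\<Prod>j<Suc k. \<phi> (mode \<sigma> \<tau> j \<omega>)) \<le> b ^ Suc k"
        proof (rule AE_I2)
          fix \<omega>
          show "norm (\<Prod>j<Suc k. \<phi> (mode \<sigma> \<tau> j \<omega>)) \<le> b ^ Suc k"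
            using prod_mono[of "{..<Suc k}" "\<lambda>j. \<phi> (mode \<sigma> \<tau> j \<omega>)" "\<lambda>_. b"] \<phi>0 b
            by (simp add: abs_prod del: prod.lessThan_Suc power_Suc)
        qed
      qed measurable
    qed (intro AE_I2 prod_nonneg ballI \<phi>0)
    finally show ?thesis by (simp only: E)
  qed
  have summable: "summable (\<lambda>k. \<rho> ^ k * E 1)"
    using \<rho>0 \<rho>1 by (intro summable_mult2 summable_geometric) simp
  have "(\<integral>\<^sup>+\<omega>. (\<Sum>k. ennreal (Z (Suc k) \<omega>)) \<partial>M) =
      (\<Sum>k. \<integral>\<^sup>+\<omega>. ennreal (Z (Suc k) \<omega>) \<partial>M)"
    by (rule nn_integral_suminf) measurable
  also have "\<dots> = (\<Sum>k. ennreal (\<rho> ^ k * E 1))" by (simp only: EZ)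
  also have "\<dots> = ennreal (\<Sum>k. \<rho> ^ k * E 1)"
    using summable \<rho>0 E0 by (intro suminf_ennreal2) auto
  finally have "(\<integral>\<^sup>+\<omega>. (\<Sum>k. ennreal (Z (Suc k) \<omega>)) \<partial>M) \<noteq> \<infinity>" by simp
  then have "AE \<omega> in M. (\<Sum>k. ennreal (Z (Suc k) \<omega>)) \<noteq> \<infinity>"
    by (intro nn_integral_PInf_AE) auto
  then show ?thesis
  proof eventually_elim
    case (elim \<omega>)
    then have "summable (\<lambda>k. Z (Suc k) \<omega>)"
      using Z0 by (intro summable_suminf_not_top) auto
    then have "(\<lambda>k. Z k \<omega>) \<longlonglongrightarrow> 0"
      by (rule LIMSEQ_imp_Suc[OF summable_LIMSEQ_zero])
    then show ?case by (simp add: Z_def)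
  qed
qed

section \<open>Divergence of the switching instants\<close>

lemma sum_mode_probabilities:
  assumes prob: "prob_space M" and sig: "switching_signal M N \<sigma> \<sigma>0 \<tau>"
    and UH: "class_UH M N \<sigma> \<tau> T q"
  shows "(\<Sum>i\<in>{1..N}. q i) = 1"
proof -
  interpret prob_space M by fact
  \<comment> \<open>That \<open>q\<close> sums to 1 is not part of \<open>class_UH\<close>. It
    follows from \<open>expectation_mode_product\<close> with this indicator, for which the products
    over one and over two modes both have expectation 1.\<close>
  define \<phi> :: "nat \<Rightarrow> real" where "\<phi> i = indicator {1..N} i" for i
  have one: "(\<integral>\<omega>. (\<Prod>j<k. \<phi> (mode \<sigma> \<tau> j \<omega>)) \<partial>M) = 1" for k
  proof -
    note mode_measurable[OF prob UH, measurable]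
    have "(\<integral>\<omega>. (\<Prod>j<k. \<phi> (mode \<sigma> \<tau> j \<omega>)) \<partial>M) = (\<integral>\<omega>. 1 \<partial>M)"
    proof (rule integral_cong_AE)
      show "AE \<omega> in M. (\<Prod>j<k. \<phi> (mode \<sigma> \<tau> j \<omega>)) = 1"
        using mode_range[OF sig] by eventually_elim (simp add: \<phi>_def)
    qed measurable
    then show ?thesis by (simp add: prob_space)
  qed
  have "(\<integral>\<omega>. (\<Prod>j<Suc 1. \<phi> (mode \<sigma> \<tau> j \<omega>)) \<partial>M) =
      (\<Sum>i\<in>{1..N}. q i * \<phi> i) * (\<integral>\<omega>. (\<Prod>j<1. \<phi> (mode \<sigma> \<tau> j \<omega>)) \<partial>M)"
    by (rule expectation_mode_product[OF prob sig UH]) (auto simp: \<phi>_def)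
  then have "(\<Sum>i\<in>{1..N}. q i * \<phi> i) = 1" unfolding one by simp
  then show ?thesis by (simp add: \<phi>_def)
qed

text \<open>With all rates and the factor \<open>c\<close> equal to 1, the contraction condition
  reduces to \<open>uniform_ratio T 1 < 1\<close>, since \<open>q\<close> sums to 1.\<close>

lemma switching_instants_tendsto_infinity:
  assumes prob: "prob_space M" and sig: "switching_signal M N \<sigma> \<sigma>0 \<tau>"
    and UH: "class_UH M N \<sigma> \<tau> T q"
  shows "AE \<omega> in M. filterlim (\<lambda>k. \<tau> k \<omega>) at_top sequentially"
proof -
  have "T > 0" using UH by (simp add: class_UH_def)
  then have "(\<Sum>i\<in>{1..N}. 1 * q i * uniform_ratio T 1) < 1"
    using sum_mode_probabilities[OF assms] uniform_ratio_less_1[of T 1]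
    by (simp flip: sum_distrib_right)
  then have "AE \<omega> in M. (\<lambda>k. \<Prod>j<k. 1 * exp (- 1 * holding_time \<tau> (Suc j) \<omega>)) \<longlonglongrightarrow> 0"
    by (intro decay_product_tendsto_0[OF assms, of 1 "\<lambda>_. 1"]) auto
  moreover have "AE \<omega> in M. \<tau> 0 \<omega> = 0"
    using sig unfolding switching_signal_def by auto
  ultimately show ?thesis
  proof eventually_elim
    case (elim \<omega>)
    \<comment> \<open>The holding times telescope in the exponent.\<close>
    have "(\<Prod>j<k. 1 * exp (- 1 * holding_time \<tau> (Suc j) \<omega>)) = exp (- \<tau> k \<omega>)" for k
      by (induction k) (auto simp: elim holding_time_def simp flip: exp_add)
    then have lim: "(\<lambda>k. exp (- \<tau> k \<omega>)) \<longlonglongrightarrow> 0" using elim by simp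
    show ?case
      unfolding filterlim_at_top_dense
    proof
      fix z
      from lim have "\<forall>\<^sub>F k in sequentially. exp (- \<tau> k \<omega>) < exp (- z)"
        by (rule order_tendstoD) simp
      then show "\<forall>\<^sub>F k in sequentially. z < \<tau> k \<omega>" by eventually_elim simp
    qed
  qed
qed

section \<open>Stability\<close>

text \<open>The endpoint \<open>\<tau> (Suc k)\<close> is included, although the mode may change
  there: the bound with the old mode is needed just before the switch is accounted for.\<close>

lemma lyapunov_along_solution:
  fixes f :: "nat \<Rightarrow> 'a::euclidean_space \<Rightarrow> 'a"
  assumes \<tau>: "\<tau> 0 = 0" "\<And>i. \<tau> i < \<tau> (Suc i)"
    and s: "\<And>i t. \<tau> i \<le> t \<Longrightarrow> t < \<tau> (Suc i) \<Longrightarrow> s t = m i" and m: "\<And>i. m i \<in> P"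
    and cont: "\<And>i. i \<in> P \<Longrightarrow> continuous_on UNIV (f i)"
    and V: "\<And>i x. i \<in> P \<Longrightarrow> V i differentiable (at x)"
    and decay: "\<And>i x. i \<in> P \<Longrightarrow> gradient (V i) x \<bullet> f i x \<le> - lam i * V i x"
    and sol: "is_solution f s x0 x" and t: "\<tau> k \<le> t" "t \<le> \<tau> (Suc k)"
  shows "V (m k) (x t) \<le> exp (- lam (m k) * (t - \<tau> k)) * V (m k) (x (\<tau> k))"
proof (cases "t = \<tau> k")
  case False
  have "strict_mono \<tau>" using \<tau>(2) by (simp add: strict_mono_Suc_iff)
  then have "0 \<le> \<tau> k"
    using \<tau>(1) monoD[OF strict_mono_mono, of \<tau> 0 k] by simp
  show ?thesis
  proof (rule exp_decay_along[where y = x and V = "V (m k)" and d = "\<lambda>r. f (m k) (x r)"])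
    show "(x has_vector_derivative f (m k) (x r)) (at r within {\<tau> k..t})" if "r \<in> {\<tau> k..t}" for r
      using s t False \<open>0 \<le> \<tau> k\<close>
      by (intro is_solution_has_vector_derivative[OF sol _ _ _ cont[OF m] that]) auto
  qed (use V decay m t in auto)
qed simp

text \<open>The state does not jump, so a switch only replaces one Lyapunov function by another at
  the same point, at the cost of \<open>\<mu>\<close>; the exponential factor comes from the
  interval just completed.\<close>

lemma lyapunov_at_switching_instants:
  fixes f :: "nat \<Rightarrow> 'a::euclidean_space \<Rightarrow> 'a"
  assumes \<tau>: "\<tau> 0 = 0" "\<And>i. \<tau> i < \<tau> (Suc i)"
    and s: "\<And>i t. \<tau> i \<le> t \<Longrightarrow> t < \<tau> (Suc i) \<Longrightarrow> s t = m i" and m: "\<And>i. m i \<in> P"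
    and cont: "\<And>i. i \<in> P \<Longrightarrow> continuous_on UNIV (f i)"
    and V: "\<And>i x. i \<in> P \<Longrightarrow> V i differentiable (at x)"
    and decay: "\<And>i x. i \<in> P \<Longrightarrow> gradient (V i) x \<bullet> f i x \<le> - lam i * V i x"
    and compare: "\<And>i j x. i \<in> P \<Longrightarrow> j \<in> P \<Longrightarrow> V i x \<le> \<mu> * V j x" and \<mu>: "0 \<le> \<mu>"
    and sol: "is_solution f s x0 x"
  shows "V (m k) (x (\<tau> k)) \<le> (\<Prod>j<k. \<mu> * exp (- lam (m j) * (\<tau> (Suc j) - \<tau> j))) * V (m 0) x0"
proof (induction k)
  case 0
  then show ?case using sol \<tau>(1) by (simp add: is_solution_def)
next
  case (Suc k)
  have "V (m (Suc k)) (x (\<tau> (Suc k))) \<le> \<mu> * V (m k) (x (\<tau> (Suc k)))"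
    using compare m by blast
  also have "\<dots> \<le> \<mu> * (exp (- lam (m k) * (\<tau> (Suc k) - \<tau> k)) * V (m k) (x (\<tau> k)))"
    using \<mu> \<tau>(2)[of k]
    by (intro mult_left_mono lyapunov_along_solution[OF \<tau> s m cont V decay sol]) auto
  also have "\<dots> \<le> \<mu> * (exp (- lam (m k) * (\<tau> (Suc k) - \<tau> k)) *
      ((\<Prod>j<k. \<mu> * exp (- lam (m j) * (\<tau> (Suc j) - \<tau> j))) * V (m 0) x0))"
    using \<mu> Suc by (intro mult_left_mono) auto
  finally show ?case by (simp only: prod.lessThan_Suc mult_ac)
qed

text \<open>Strict pointwise bounds give only a weak bound on a supremum; halving
  \<open>\<epsilon>\<close> restores strictness.\<close>

lemma SUP_norm_less:
  assumes "0 < \<epsilon>" "\<And>t. t \<in> S \<Longrightarrow> norm (x t) < \<epsilon> / 2"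
  shows "(SUP t\<in>S. ereal (norm (x t))) < ereal \<epsilon>"
proof -
  have "(SUP t\<in>S. ereal (norm (x t))) \<le> ereal (\<epsilon> / 2)"
    using assms(2) by (intro SUP_least) (auto simp: less_imp_le)
  also have "\<dots> < ereal \<epsilon>" using assms(1) by simp
  finally show ?thesis .
qed

text \<open>This is the deterministic core, for one fixed path. The bound \<open>T\<close> on the
  holding times limits how much a Lyapunov function with negative rate can grow between two
  switches.\<close>

lemma switched_path_stability:
  fixes f :: "nat \<Rightarrow> 'a::euclidean_space \<Rightarrow> 'a"
  assumes \<tau>: "\<tau> 0 = 0" "\<And>i. \<tau> i < \<tau> (Suc i)" "filterlim \<tau> at_top sequentially"
    and T: "\<And>i. \<tau> (Suc i) - \<tau> i \<le> T"
    and s: "\<And>i t. \<tau> i \<le> t \<Longrightarrow> t < \<tau> (Suc i) \<Longrightarrow> s t = m i" and m: "\<And>i. m i \<in> P"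
    and P: "finite P"
    and lip: "\<And>i. i \<in> P \<Longrightarrow> local_lipschitz (UNIV :: real set) UNIV (\<lambda>_. f i)"
    and V: "\<And>i x. i \<in> P \<Longrightarrow> V i differentiable (at x)"
    and K: "class_K_inf \<alpha>1" "class_K_inf \<alpha>2"
    and lower: "\<And>i x. i \<in> P \<Longrightarrow> \<alpha>1 (norm x) \<le> V i x"
    and upper: "\<And>i x. i \<in> P \<Longrightarrow> V i x \<le> \<alpha>2 (norm x)"
    and decay: "\<And>i x. i \<in> P \<Longrightarrow> gradient (V i) x \<bullet> f i x \<le> - lam i * V i x"
    and compare: "\<And>i j x. i \<in> P \<Longrightarrow> j \<in> P \<Longrightarrow> V i x \<le> \<mu> * V j x" and \<mu>: "0 \<le> \<mu>"
    and Z: "(\<lambda>k. \<Prod>j<k. \<mu> * exp (- lam (m j) * (\<tau> (Suc j) - \<tau> j))) \<longlonglongrightarrow> 0"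
  shows "\<forall>x0. \<exists>x. is_solution f s x0 x"
    and "\<forall>\<epsilon>>0. \<exists>\<delta>>0. \<forall>x0 x. is_solution f s x0 x \<and> norm x0 < \<delta> \<longrightarrow>
      (SUP t\<in>{0..}. ereal (norm (x t))) < ereal \<epsilon>"
    and "\<forall>r>0. \<forall>\<epsilon>>0. \<exists>T\<ge>0. \<forall>x0 x. is_solution f s x0 x \<and> norm x0 < r \<longrightarrow>
      (SUP t\<in>{T..}. ereal (norm (x t))) < ereal \<epsilon>"
proof -
  have mono: "strict_mono \<tau>" using \<tau>(2) by (simp add: strict_mono_Suc_iff)
  have \<tau>_nonneg: "0 \<le> \<tau> i" for i
    using \<tau>(1) monoD[OF strict_mono_mono[OF mono], of 0 i] by simp
  have cont: "continuous_on UNIV (f i)" if "i \<in> P" for i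
    using local_lipschitz_continuous_on[OF lip[OF that], of 0] by simp
  have V0: "0 \<le> V i x" if "i \<in> P" for i x
    using lower[OF that, of x] class_K_inf_nonneg[OF K(1), of "norm x"] by simp
  define Z where "Z k = (\<Prod>j<k. \<mu> * exp (- lam (m j) * (\<tau> (Suc j) - \<tau> j)))" for k
  have Z0: "0 \<le> Z k" for k unfolding Z_def using \<mu> by (intro prod_nonneg) auto
  have Zlim: "Z \<longlonglongrightarrow> 0" using Z by (simp add: Z_def[abs_def])
  \<comment> \<open>\<open>C\<close> bounds the growth within an interval, uniformly over modes and
    regardless of the signs of the rates.\<close>
  define C where "C = exp ((\<Sum>i\<in>P. \<bar>lam i\<bar>) * T)"
  have C: "C > 0" by (simp add: C_def)
  have key: "\<alpha>1 (norm (x t)) \<le> Z k * (C * \<alpha>2 (norm x0))"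
    if sol: "is_solution f s x0 x" and t: "\<tau> k \<le> t" "t < \<tau> (Suc k)" for x x0 t k
  proof -
    have "\<alpha>1 (norm (x t)) \<le> V (m k) (x t)" using lower m by blast
    also have "\<dots> \<le> exp (- lam (m k) * (t - \<tau> k)) * V (m k) (x (\<tau> k))"
      using t by (intro lyapunov_along_solution[OF \<tau>(1,2) s m cont V decay sol]) auto
    also have "\<dots> \<le> C * V (m k) (x (\<tau> k))"
    proof (rule mult_right_mono)
      have "- lam (m k) * (t - \<tau> k) \<le> \<bar>lam (m k)\<bar> * (t - \<tau> k)"
        using t by (intro mult_right_mono) auto
      also have "\<dots> \<le> (\<Sum>i\<in>P. \<bar>lam i\<bar>) * T"
        using t T[of k] m P by (intro mult_mono member_le_sum sum_nonneg) auto
      finally show "exp (- lam (m k) * (t - \<tau> k)) \<le> C" by (simp add: C_def)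
    qed (rule V0[OF m])
    also have "\<dots> \<le> C * (Z k * V (m 0) x0)"
      using C lyapunov_at_switching_instants[OF \<tau>(1,2) s m cont V decay compare \<mu> sol]
      unfolding Z_def by (intro mult_left_mono) auto
    also have "\<dots> \<le> C * (Z k * \<alpha>2 (norm x0))"
      using C Z0 upper[OF m] by (intro mult_left_mono) auto
    finally show ?thesis by (simp add: mult_ac)
  qed
  show "\<forall>x0. \<exists>x. is_solution f s x0 x"
  proof
    fix x0
    show "\<exists>x. is_solution f s x0 x"
    proof (rule switched_solution_exists[where f = f and m = m, OF \<tau> s])
      show "continuous_on UNIV (f (m i))" for i by (rule cont[OF m])
      fix i p
      have "0 \<le> \<tau> (Suc i) - \<tau> i" using \<tau>(2)[of i] by simp
      from lyapunov_solution_exists[OF lip[OF m] V[OF m] K(1) lower[OF m] decay[OF m] this]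
      show "\<exists>y. y 0 = p \<and> (\<forall>t\<in>{0..\<tau> (Suc i) - \<tau> i}.
          (y has_vector_derivative f (m i) (y t)) (at t within {0..\<tau> (Suc i) - \<tau> i}))"
        by metis
    qed
  qed
  show "\<forall>\<epsilon>>0. \<exists>\<delta>>0. \<forall>x0 x. is_solution f s x0 x \<and> norm x0 < \<delta> \<longrightarrow>
      (SUP t\<in>{0..}. ereal (norm (x t))) < ereal \<epsilon>"
  proof (intro allI impI)
    fix \<epsilon> :: real assume \<epsilon>: "\<epsilon> > 0"
    obtain B where B: "B > 0" "\<And>k. Z k \<le> B"
      using Zlim Z0 by (force dest!: convergentI convergent_imp_Bseq simp: Bseq_def)
    \<comment> \<open>\<open>e\<close> is chosen so that \<open>\<alpha>2 (norm x0) < e\<close>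
      keeps the estimate \<open>key\<close> below \<open>\<alpha>1 (\<epsilon> / 2)\<close>, with
      \<open>B\<close> in place of \<open>Z k\<close>.\<close>
    define e where "e = \<alpha>1 (\<epsilon> / 2) / (B * C)"
    have "e > 0" using class_K_inf_pos[OF K(1), of "\<epsilon> / 2"] \<epsilon> B C by (simp add: e_def)
    then obtain d where d: "d > 0" "\<And>r. 0 \<le> r \<Longrightarrow> r < d \<Longrightarrow> \<alpha>2 r < e"
      using class_K_inf_continuous[OF K(2)] class_K_inf_zero[OF K(2)]
      unfolding continuous_on_iff by (force simp: dist_real_def)
    show "\<exists>\<delta>>0. \<forall>x0 x. is_solution f s x0 x \<and> norm x0 < \<delta> \<longrightarrow>
        (SUP t\<in>{0..}. ereal (norm (x t))) < ereal \<epsilon>"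
    proof (intro exI[of _ d] conjI allI impI d)
      fix x0 x assume H: "is_solution f s x0 x \<and> norm x0 < d"
      show "(SUP t\<in>{0..}. ereal (norm (x t))) < ereal \<epsilon>"
      proof (rule SUP_norm_less[OF \<epsilon>])
        fix t :: real assume "t \<in> {0..}"
        then have "0 \<le> t" by simp
        then obtain k where k: "\<tau> k \<le> t" "t < \<tau> (Suc k)"
          by (rule switching_index[OF \<tau>])
        have "\<alpha>1 (norm (x t)) \<le> Z k * (C * \<alpha>2 (norm x0))" using key H k by blast
        also have "\<dots> \<le> B * (C * \<alpha>2 (norm x0))"
          using B C class_K_inf_nonneg[OF K(2)] by (intro mult_right_mono) auto
        also have "\<dots> < B * (C * e)"
          using d(2)[of "norm x0"] H B C by (intro mult_strict_left_mono) auto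
        also have "\<dots> = \<alpha>1 (\<epsilon> / 2)" using B C by (simp add: e_def)
        finally show "norm (x t) < \<epsilon> / 2"
          by (rule class_K_inf_less_cancel[OF K(1), rotated 2]) (use \<epsilon> in auto)
      qed
    qed
  qed
  show "\<forall>r>0. \<forall>\<epsilon>>0. \<exists>T\<ge>0. \<forall>x0 x. is_solution f s x0 x \<and> norm x0 < r \<longrightarrow>
      (SUP t\<in>{T..}. ereal (norm (x t))) < ereal \<epsilon>"
  proof (intro allI impI)
    fix r \<epsilon> :: real assume r: "r > 0" and \<epsilon>: "\<epsilon> > 0"
    have "(\<lambda>k. Z k * (C * \<alpha>2 r)) \<longlonglongrightarrow> 0 * (C * \<alpha>2 r)"
      by (intro tendsto_intros Zlim)
    then have "\<forall>\<^sub>F k in sequentially. Z k * (C * \<alpha>2 r) < \<alpha>1 (\<epsilon> / 2)"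
      using class_K_inf_pos[OF K(1), of "\<epsilon> / 2"] \<epsilon> by (intro order_tendstoD) auto
    \<comment> \<open>\<open>n\<close> depends on \<open>r\<close> but not on the initial state, so
      \<open>\<tau> n\<close> serves all initial states in the ball at once.\<close>
    then obtain n where n: "\<And>k. n \<le> k \<Longrightarrow> Z k * (C * \<alpha>2 r) < \<alpha>1 (\<epsilon> / 2)"
      by (auto simp: eventually_sequentially)
    show "\<exists>T\<ge>0. \<forall>x0 x. is_solution f s x0 x \<and> norm x0 < r \<longrightarrow>
        (SUP t\<in>{T..}. ereal (norm (x t))) < ereal \<epsilon>"
    proof (intro exI[of _ "\<tau> n"] conjI allI impI \<tau>_nonneg)
      fix x0 x assume H: "is_solution f s x0 x \<and> norm x0 < r"
      show "(SUP t\<in>{\<tau> n..}. ereal (norm (x t))) < ereal \<epsilon>"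
      proof (rule SUP_norm_less[OF \<epsilon>])
        fix t :: real assume t: "t \<in> {\<tau> n..}"
        then have "0 \<le> t" using \<tau>_nonneg[of n] by simp
        then obtain k where k: "\<tau> k \<le> t" "t < \<tau> (Suc k)"
          by (rule switching_index[OF \<tau>])
        then have "\<tau> n < \<tau> (Suc k)" using t by simp
        then have "n \<le> k" using strict_mono_less[OF mono] by simp
        have "\<alpha>1 (norm (x t)) \<le> Z k * (C * \<alpha>2 (norm x0))" using key H k by blast
        also have "\<dots> \<le> Z k * (C * \<alpha>2 r)"
          using Z0 C H class_K_inf_mono[OF K(2), of "norm x0" r] by (intro mult_left_mono) auto
        also have "\<dots> < \<alpha>1 (\<epsilon> / 2)" using n \<open>n \<le> k\<close> .
        finally show "norm (x t) < \<epsilon> / 2"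
          by (rule class_K_inf_less_cancel[OF K(1), rotated 2]) (use \<epsilon> in auto)
      qed
    qed
  qed
qed

section \<open>From almost sure path properties to stability\<close>

lemma holding_time_le:
  assumes prob: "prob_space M" and UH: "class_UH M N \<sigma> \<tau> T q"
  shows "AE \<omega> in M. \<forall>i. holding_time \<tau> (Suc i) \<omega> \<le> T"
  unfolding AE_all_countable
proof
  fix i
  interpret prob_space M by fact
  have "T > 0" and indep: "indep_vars (\<lambda>_. borel) (holding_time \<tau>) {1..}"
    and unif: "distr M lborel (holding_time \<tau> (Suc i)) = uniform_measure lborel {0..T}"
    using UH by (auto simp: class_UH_def)
  have "holding_time \<tau> (Suc i) \<in> measurable M lborel"
    using indep by (auto simp: indep_vars_def)
  moreover have "AE x in distr M lborel (holding_time \<tau> (Suc i)). x \<le> T"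
    unfolding unif by (rule AE_uniform_measureI) auto
  ultimately show "AE \<omega> in M. holding_time \<tau> (Suc i) \<omega> \<le> T"
    by (rule AE_distrD)
qed

theorem theorem3p4:
  fixes M :: "'w measure"
    and N :: nat
    and f :: "nat \<Rightarrow> real ^ 'n \<Rightarrow> real ^ 'n"
    and \<sigma> :: "real \<Rightarrow> 'w \<Rightarrow> nat" and \<sigma>0 :: nat
    and \<tau> :: "nat \<Rightarrow> 'w \<Rightarrow> real"
    and V :: "nat \<Rightarrow> real ^ 'n \<Rightarrow> real"
    and \<alpha>1 \<alpha>2 :: "real \<Rightarrow> real"
    and \<mu> T :: real
    and lam q :: "nat \<Rightarrow> real"
  assumes prob: "prob_space M" and complete: "complete_measure M"
    and f_lipschitz: "\<forall>i\<in>{1..N}. local_lipschitz (UNIV :: real set) UNIV (\<lambda>_. f i)"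
    and f_zero: "\<forall>i\<in>{1..N}. f i 0 = 0"
    and signal: "switching_signal M N \<sigma> \<sigma>0 \<tau>"
    and U1_C1: "\<forall>i\<in>{1..N}. continuously_differentiable (V i)"
    and U1_alpha: "class_K_inf \<alpha>1" "class_K_inf \<alpha>2"
    and U1_mu: "\<mu> > 1"
    and U1_bounds: "\<forall>x. \<forall>i\<in>{1..N}. \<alpha>1 (norm x) \<le> V i x \<and> V i x \<le> \<alpha>2 (norm x)"
    and U1_decay: "\<forall>x. \<forall>i\<in>{1..N}. gradient (V i) x \<bullet> f i x \<le> - lam i * V i x"
    and U1_compare: "\<forall>x. \<forall>i\<in>{1..N}. \<forall>j\<in>{1..N}. V i x \<le> \<mu> * V j x"
    and U2: "class_UH M N \<sigma> \<tau> T q"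
    and U3: "(\<Sum>i\<in>{1..N}. \<mu> * q i * uniform_ratio T (lam i)) < 1"
  shows "gas_almost_surely M f \<sigma>"
proof -
  have "AE \<omega> in M. \<tau> 0 \<omega> = 0 \<and> (\<forall>i. \<tau> i \<omega> < \<tau> (Suc i) \<omega>)"
    and "AE \<omega> in M. \<forall>i. \<forall>t. \<tau> i \<omega> \<le> t \<and> t < \<tau> (Suc i) \<omega> \<longrightarrow> \<sigma> t \<omega> = \<sigma> (\<tau> i \<omega>) \<omega>"
    using signal by (simp_all only: switching_signal_def)
  moreover have "AE \<omega> in M.
      (\<lambda>k. \<Prod>j<k. \<mu> * exp (- lam (mode \<sigma> \<tau> j \<omega>) * holding_time \<tau> (Suc j) \<omega>)) \<longlonglongrightarrow> 0"
    using U1_mu by (intro decay_product_tendsto_0[OF prob signal U2 _ U3]) simp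
  moreover note switching_instants_tendsto_infinity[OF prob signal U2]
    mode_range[OF signal] holding_time_le[OF prob U2]
  \<comment> \<open>Finitely many almost sure events are intersected; on their intersection the
    deterministic result yields existence and both stability properties together.\<close>
  ultimately have "AE \<omega> in M.
      (\<forall>x0. \<exists>x. is_solution f (\<lambda>t. \<sigma> t \<omega>) x0 x) \<and>
      (\<forall>\<epsilon>>0. \<exists>\<delta>>0. \<forall>x0 x. is_solution f (\<lambda>t. \<sigma> t \<omega>) x0 x \<and> norm x0 < \<delta> \<longrightarrow>
        (SUP t\<in>{0..}. ereal (norm (x t))) < ereal \<epsilon>) \<and>
      (\<forall>r>0. \<forall>\<epsilon>>0. \<exists>T\<ge>0. \<forall>x0 x. is_solution f (\<lambda>t. \<sigma> t \<omega>) x0 x \<and> norm x0 < r \<longrightarrow>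
        (SUP t\<in>{T..}. ereal (norm (x t))) < ereal \<epsilon>)"
  proof eventually_elim
    case (elim \<omega>)
    have path: "\<tau> 0 \<omega> = 0" "\<And>i. \<tau> i \<omega> < \<tau> (Suc i) \<omega>"
      "filterlim (\<lambda>i. \<tau> i \<omega>) at_top sequentially"
      "\<And>i. \<tau> (Suc i) \<omega> - \<tau> i \<omega> \<le> T"
      "\<And>i t. \<tau> i \<omega> \<le> t \<Longrightarrow> t < \<tau> (Suc i) \<omega> \<Longrightarrow> \<sigma> t \<omega> = mode \<sigma> \<tau> i \<omega>"
      "\<And>i. mode \<sigma> \<tau> i \<omega> \<in> {1..N}"
      "(\<lambda>k. \<Prod>j<k. \<mu> * exp (- lam (mode \<sigma> \<tau> j \<omega>) * (\<tau> (Suc j) \<omega> - \<tau> j \<omega>))) \<longlonglongrightarrow> 0"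
      using elim by (simp_all add: holding_time_def mode_def)
    have lyap: "local_lipschitz (UNIV :: real set) UNIV (\<lambda>_. f i)" "V i differentiable (at x)"
      "\<alpha>1 (norm x) \<le> V i x" "V i x \<le> \<alpha>2 (norm x)"
      "gradient (V i) x \<bullet> f i x \<le> - lam i * V i x"
      if "i \<in> {1..N}" for i x
      using that f_lipschitz U1_C1 U1_bounds U1_decay
      by (auto simp: continuously_differentiable_def)
    have compare: "V i x \<le> \<mu> * V j x" if "i \<in> {1..N}" "j \<in> {1..N}" for i j x
      using that U1_compare by blast
    have \<mu>: "0 \<le> \<mu>" using U1_mu by simp
    show ?case
      by (intro conjI switched_path_stability[where \<tau> = "\<lambda>i. \<tau> i \<omega>" and P = "{1..N}" and
            m = "\<lambda>i. mode \<sigma> \<tau> i \<omega>" and V = V and ?\<alpha>1.0 = \<alpha>1 and ?\<alpha>2.0 = \<alpha>2 and lam = lam and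
            \<mu> = \<mu> and T = T])
        (assumption | rule path lyap compare U1_alpha \<mu> finite_atLeastAtMost)+
  qed
  then show ?thesis
    unfolding gas_almost_surely_def AE_conj_iff .
qed

end
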